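(* For a positive integer $b$, let $(v_n)_{n\geq 0}$ be defined by $v_0=2$, $v_1=b$, and $v_n=bv_{n-1}+v_{n-2}$ for $n\geq 2$. Then the only solutions in nonnegative integers $(n,x,y)$ of $\varphi(v_n)=2^x3^y$ are: (1) for $b=3$: $(n,x,y)=(0,0,0),(1,1,0),(3,2,1),(4,5,1),(9,6,5)$; (2) for $b=5$: $(n,x,y)=(0,0,0),(1,2,0),(2,0,2),(3,4,3)$; (3) for $b=7$: $(n,x,y)=(0,0,0),(1,1,1),(2,5,0),(3,5,2),(6,9,4)$.
   Context: $\varphi$ denotes Euler's totient function.
   Formalization: Three printed solutions are false and corrected: for b=5, (2,0,2) becomes (2,1,2) since φ(27)=18, and (3,4,3) becomes (3,4,1) since φ(140)=48; for b=7, (3,5,2) becomes (3,4,2) since φ(364)=144. *)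

theory Defs
  imports "HOL-Number_Theory.Number_Theory"
begin

fun companion_seq :: "nat \<Rightarrow> nat \<Rightarrow> nat" where
  "companion_seq b 0 = 2"
| "companion_seq b (Suc 0) = b"
| "companion_seq b (Suc (Suc n)) = b * companion_seq b (Suc n) + companion_seq b n"

end

(* Write al, be for the roots of X^2 - b X - 1, so v_n = al^n + be^n, and let u_n be the fundamental
   sequence with v_n^2 - (b^2 + 4) u_n^2 = 4 (-1)^n. If the totient of v_n is 2^x 3^y, then so is that of
   v_m for every m with n/m odd, and every prime factor p of v_n has p - 1 of this form. Reducing the norm
   equation modulo p decides the quadratic character of b^2 + 4: for n odd or p = 1 mod 4 the rank of p in
   (u_n) divides p - 1, otherwise it divides p + 1 and p = 2 * 3^j + 1.

   Powers of 2: for a >= 3 all primes dividing v_(2^a) would be 1 mod 8, but v_(2^a) = 7 mod 8.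

   Primes q > 3 dividing n: take n = 2^a q. The rank of a prime factor p of v_n / v_(2^a) is 2 n, and q
   does not divide p - 1, so a > 0, p = 2 * 3^j + 1 and 2^a q divides 3^j + 1. For the least such p the
   whole quotient is 1 mod 3^j. Since v_n - v_(2^a) is (b^2 + 4) times a product of two values of u with
   indices 2^(a-1) (q + 1) and 2^(a-1) (q - 1), the 3-adic valuation of u makes 3^j divide, up to a bounded
   factor, q - 1 or q + 1. This contradicts q dividing 3^j + 1 for reasons of size.

   So n = 2^a 3^c with a <= 2, and finitely many explicit values of v finish the proof. *)

theory Submission
  imports Defs
begin

subsection \<open>Lucas sequences\<close>

fun fundamental_seq :: "nat \<Rightarrow> nat \<Rightarrow> nat" where
  "fundamental_seq b 0 = 0"
| "fundamental_seq b (Suc 0) = 1"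
| "fundamental_seq b (Suc (Suc n)) = b * fundamental_seq b (Suc n) + fundamental_seq b n"

abbreviation U :: "nat \<Rightarrow> nat \<Rightarrow> int" where "U b n \<equiv> int (fundamental_seq b n)"
abbreviation V :: "nat \<Rightarrow> nat \<Rightarrow> int" where "V b n \<equiv> int (companion_seq b n)"
abbreviation disc :: "nat \<Rightarrow> int" where "disc b \<equiv> int b ^ 2 + 4"

lemma companion_eq: "V b n = 2 * U b (Suc n) - int b * U b n"
  by (induction b n rule: companion_seq.induct) (simp_all add: algebra_simps)

lemma companion_Suc: "2 * V b (Suc n) = int b * V b n + disc b * U b n"
  by (simp add: companion_eq algebra_simps power2_eq_square)

lemma fundamental_Suc: "2 * U b (Suc n) = int b * U b n + V b n"
  by (simp add: companion_eq)

lemma fundamental_pred: "2 * U b n = V b (Suc n) - int b * U b (Suc n)"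
  by (simp add: companion_eq algebra_simps)

text \<open>With D = b^2 + 4 and al^n = (v_n + u_n sqrt D) / 2, these are the two coordinates of
  al^(m+n) = al^m al^n. They are proved together because the induction step for each uses both; the
  factor 2 avoids halves.\<close>

lemma add_formulas:
  "2 * U b (m + n) = U b m * V b n + U b n * V b m \<and>
   2 * V b (m + n) = V b m * V b n + disc b * U b m * U b n"
proof (induction m)
  case 0
  then show ?case by simp
next
  case (Suc m)
  have u: "4 * U b (Suc m + n) = int b * (2 * U b (m + n)) + 2 * V b (m + n)"
    using fundamental_Suc[of b "m + n"] by simp
  have v: "4 * V b (Suc m + n) = int b * (2 * V b (m + n)) + disc b * (2 * U b (m + n))"
    using companion_Suc[of b "m + n"] by (simp add: algebra_simps)
  have "4 * U b (Suc m + n) = 2 * U b (Suc m) * V b n + U b n * (2 * V b (Suc m))"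
    unfolding u fundamental_Suc companion_Suc
    unfolding Suc[THEN conjunct1] Suc[THEN conjunct2] by (simp add: algebra_simps)
  moreover have "4 * V b (Suc m + n) = 2 * V b (Suc m) * V b n + disc b * (2 * U b (Suc m)) * U b n"
    unfolding v fundamental_Suc companion_Suc
    unfolding Suc[THEN conjunct1] Suc[THEN conjunct2] by (simp add: algebra_simps)
  ultimately show ?case by simp
qed

lemmas fundamental_add = add_formulas[THEN conjunct1]
lemmas companion_add = add_formulas[THEN conjunct2]

text \<open>The norm of 2 al^n, where al be = -1; the step from n to n + 1 multiplies it by (b^2 -
  D) / 4 = -1.\<close>

lemma norm_equation: "V b n ^ 2 - disc b * U b n ^ 2 = 4 * (-1) ^ n"
proof (induction n)
  case 0
  then show ?case by simp
next
  case (Suc n)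
  have "4 * (V b (Suc n) ^ 2 - disc b * U b (Suc n) ^ 2)
      = (2 * V b (Suc n)) ^ 2 - disc b * (2 * U b (Suc n)) ^ 2"
    by (simp add: power_mult_distrib algebra_simps)
  also have "\<dots> = (int b ^ 2 - disc b) * (V b n ^ 2 - disc b * U b n ^ 2)"
    unfolding companion_Suc fundamental_Suc by (simp add: algebra_simps power2_eq_square)
  also have "\<dots> = 4 * (4 * (-1) ^ Suc n)"
    unfolding Suc by simp
  finally show ?case by simp
qed

lemma fundamental_double: "U b (2 * n) = U b n * V b n"
  using fundamental_add[of b n n] unfolding mult_2[of n] by simp

lemma fundamental_double_nat: "fundamental_seq b (2 * n) = fundamental_seq b n * companion_seq b n"
  by (metis fundamental_double of_nat_eq_iff of_nat_mult)

lemma companion_double: "V b (2 * n) = V b n ^ 2 - 2 * (-1) ^ n"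
  using companion_add[of b n n] norm_equation[of b n]
  unfolding mult_2[of n] power2_eq_square by (simp add: mult.assoc)

text \<open>Comes from multiplying al^(k+m) by the conjugate of al^m, which gives (-1)^m al^k, and
  comparing rational parts.\<close>

lemma norm_shift:
  "V b (k + m) * V b m - disc b * U b (k + m) * U b m = 2 * (-1) ^ m * V b k"
proof -
  have "2 * (V b (k + m) * V b m - disc b * U b (k + m) * U b m)
      = (2 * V b (k + m)) * V b m - disc b * (2 * U b (k + m)) * U b m"
    by (simp add: algebra_simps)
  also have "\<dots> = V b k * (V b m ^ 2 - disc b * U b m ^ 2)"
    unfolding companion_add fundamental_add by (simp add: algebra_simps power2_eq_square)
  also have "\<dots> = 2 * (2 * (-1) ^ m * V b k)"
    unfolding norm_equation by simp
  finally show ?thesis by simp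
qed

text \<open>\<open>companion_add\<close> gives the sum of v_(k+m) v_m and D u_(k+m) u_m, and
  \<open>norm_shift\<close> gives their difference; solving for each product yields the two
  claims.\<close>

lemma companion_shift: "V b (k + 2 * m) = V b (k + m) * V b m - (-1) ^ m * V b k"
  and companion_diff: "V b (k + 2 * m) - (-1) ^ m * V b k = disc b * U b (k + m) * U b m"
proof -
  have half: "x = p - s * w \<and> x - s * w = d" if "2 * x = p + d" "p - d = 2 * s * w" for x p d s w :: int
    using that by (simp add: mult.assoc)
  have "2 * V b (k + 2 * m) = V b (k + m) * V b m + disc b * U b (k + m) * U b m"
    using companion_add[of b "k + m" m] by (simp only: mult_2 add.assoc)
  from half[OF this norm_shift]
  show "V b (k + 2 * m) = V b (k + m) * V b m - (-1) ^ m * V b k"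
    and "V b (k + 2 * m) - (-1) ^ m * V b k = disc b * U b (k + m) * U b m"
    by blast+
qed

lemma fundamental_triple:
  assumes "even n"
  shows "U b (3 * n) = U b n * (disc b * U b n ^ 2 + 3)"
proof -
  have "2 * U b (2 * n + n) = U b (2 * n) * V b n + U b n * V b (2 * n)"
    by (rule fundamental_add)
  also have "\<dots> = U b n * (2 * V b n ^ 2 - 2)"
    unfolding fundamental_double companion_double using assms by (simp add: algebra_simps power2_eq_square)
  also have "V b n ^ 2 = disc b * U b n ^ 2 + 4"
    using norm_equation[of b n] assms by simp
  finally show ?thesis by (simp add: algebra_simps)
qed

text \<open>Modulo v_m one has al^m = - be^m, hence al^(2m) = - al^m be^m = - (-1)^m, and likewise
  for be.\<close>

lemma companion_mult_cong:
  "[V b (2 * m * j) = 2 * (- ((-1) ^ m)) ^ j] (mod V b m)"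
proof (induction j)
  case 0
  then show ?case by simp
next
  case (Suc j)
  have "V b (2 * m * Suc j) = V b (2 * m * j + m) * V b m + - ((-1) ^ m) * V b (2 * m * j)"
    using companion_shift[of b "2 * m * j" m] by (simp add: algebra_simps)
  moreover have "[\<dots> = 0 + - ((-1) ^ m) * (2 * (- ((-1) ^ m)) ^ j)] (mod V b m)"
    by (intro cong_add cong_mult Suc) (auto simp: cong_0_iff)
  ultimately show ?case
    by (simp only: power_Suc add_0 mult.left_commute[of "- ((-1) ^ m)" 2])
qed

text \<open>With s = - (-1)^m, passing from k to k + 1 multiplies the quotient by s and adds
  v_(2m(k+1)), which is 2 s^(k+1) modulo v_m. So the quotient is plus or minus 2k + 1 modulo
  v_m.\<close>

lemma companion_odd_mult:
  "\<exists>R. V b (m * (2 * k + 1)) = V b m * R \<and> [R = (- ((-1) ^ m)) ^ k * (2 * int k + 1)] (mod V b m)"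
proof (induction k)
  case 0
  then show ?case by (auto intro!: exI[of _ 1])
next
  case (Suc k)
  then obtain R where R: "V b (m * (2 * k + 1)) = V b m * R"
    "[R = (- ((-1) ^ m)) ^ k * (2 * int k + 1)] (mod V b m)" by blast
  define s :: int where "s = - ((-1) ^ m)"
  have "V b (m * (2 * Suc k + 1)) = V b (2 * m * Suc k) * V b m + s * V b (m * (2 * k + 1))"
    using companion_shift[of b "m * (2 * k + 1)" m] by (simp add: s_def algebra_simps)
  then have "V b (m * (2 * Suc k + 1)) = V b m * (V b (2 * m * Suc k) + s * R)"
    using R(1) by (simp add: algebra_simps)
  moreover have "[V b (2 * m * Suc k) + s * R = 2 * s ^ Suc k + s * (s ^ k * (2 * int k + 1))] (mod V b m)"
    using companion_mult_cong[of b m "Suc k"] R(2) unfolding s_def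
    by (intro cong_add cong_mult) auto
  moreover have "2 * s ^ Suc k + s * (s ^ k * (2 * int k + 1)) = s ^ Suc k * (2 * int (Suc k) + 1)"
    by (simp add: algebra_simps)
  ultimately show ?case unfolding s_def by metis
qed

lemma companion_dvd_odd_mult:
  assumes "odd k" shows "companion_seq b m dvd companion_seq b (m * k)"
proof -
  obtain j where "k = 2 * j + 1" using assms by (elim oddE)
  then have "V b m dvd V b (m * k)" using companion_odd_mult[of b m j] by (metis dvd_triv_left)
  then show ?thesis by simp
qed

section \<open>Strong divisibility of the sequence u\<close>

lemma coprime_fundamental_Suc: "coprime (fundamental_seq b n) (fundamental_seq b (Suc n))"
proof (induction n)
  case 0
  then show ?case by simp
next
  case (Suc n)
  have "gcd (fundamental_seq b (Suc n)) (fundamental_seq b (Suc (Suc n)))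
      = gcd (fundamental_seq b (Suc n)) (fundamental_seq b n)"
    using gcd_add_mult[of "fundamental_seq b (Suc n)" b "fundamental_seq b n"] by simp
  then show ?case using Suc by (metis coprime_iff_gcd_eq_1 gcd.commute)
qed

lemma fundamental_add_Suc:
  "fundamental_seq b (m + Suc n)
   = fundamental_seq b (Suc m) * fundamental_seq b (Suc n) + fundamental_seq b m * fundamental_seq b n"
proof (induction b m rule: fundamental_seq.induct)
  case (3 b m)
  have "fundamental_seq b (Suc (Suc m) + Suc n)
      = b * fundamental_seq b (Suc m + Suc n) + fundamental_seq b (m + Suc n)"
    by simp
  also have "\<dots> = b * (fundamental_seq b (Suc (Suc m)) * fundamental_seq b (Suc n)
      + fundamental_seq b (Suc m) * fundamental_seq b n)
      + (fundamental_seq b (Suc m) * fundamental_seq b (Suc n) + fundamental_seq b m * fundamental_seq b n)"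
    by (simp only: 3)
  also have "\<dots> = fundamental_seq b (Suc (Suc (Suc m))) * fundamental_seq b (Suc n)
      + fundamental_seq b (Suc (Suc m)) * fundamental_seq b n"
    by (simp add: algebra_simps)
  finally show ?case .
qed simp_all

lemma gcd_fundamental_add:
  "gcd (fundamental_seq b m) (fundamental_seq b (m + n)) = gcd (fundamental_seq b m) (fundamental_seq b n)"
proof (cases n)
  case 0
  then show ?thesis by simp
next
  case (Suc k)
  let ?u = "fundamental_seq b"
  have "gcd (?u m) (?u (m + n)) = gcd (?u m) (?u (Suc m) * ?u n)"
    using gcd_add_mult[of "?u m" "?u k" "?u (Suc m) * ?u n"]
    by (simp only: Suc fundamental_add_Suc) (simp add: ac_simps)
  also have "\<dots> = gcd (?u m) (?u n)"
    using coprime_fundamental_Suc[of b m] by (rule gcd_mult_right_left_cancel)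
  finally show ?thesis .
qed

text \<open>Euclid's algorithm by subtraction on the indices, with
  \<open>gcd_fundamental_add\<close> as one step. It turns questions about common divisors of values
  of u into gcds of indices.\<close>

lemma gcd_fundamental: "gcd (fundamental_seq b m) (fundamental_seq b n) = fundamental_seq b (gcd m n)"
proof (induction "m + n" arbitrary: m n rule: less_induct)
  case less
  show ?case
  proof (cases "m = 0 \<or> n = 0")
    case True
    then show ?thesis by auto
  next
    case False
    show ?thesis
    proof (cases "m \<le> n")
      case True
      then obtain k where k: "n = m + k" using le_Suc_ex by blast
      show ?thesis using less[of m k] False unfolding k by (simp add: gcd_fundamental_add)
    next
      case m: False
      then obtain k where k: "m = n + k" using le_Suc_ex nat_le_linear by blast
      have "gcd (fundamental_seq b m) (fundamental_seq b n)
          = gcd (fundamental_seq b n) (fundamental_seq b (n + k))"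
        unfolding k by (rule gcd.commute)
      also have "\<dots> = fundamental_seq b (gcd n k)"
        unfolding gcd_fundamental_add using less[of n k] False k by simp
      also have "gcd n k = gcd m n"
        unfolding k by (metis gcd.commute gcd_add2)
      finally show ?thesis .
    qed
  qed
qed

lemma fundamental_dvd: "m dvd n \<Longrightarrow> fundamental_seq b m dvd fundamental_seq b n"
  by (metis gcd_fundamental gcd_nat.absorb_iff1)

subsection \<open>Ranks of apparition\<close>

text \<open>The expansion of (b + X)^k with every X^i replaced by \<open>f i\<close>. For X = sqrt D
  the rational and irrational parts become two integer sums, so the computation stays in the
  integers.\<close>

definition binomial_sum :: "int \<Rightarrow> nat \<Rightarrow> (nat \<Rightarrow> int) \<Rightarrow> int" where
  "binomial_sum b k f = (\<Sum>i\<le>k. of_nat (k choose i) * b ^ (k - i) * f i)"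

lemma binomial_sum_0 [simp]: "binomial_sum b 0 f = f 0"
  by (simp add: binomial_sum_def)

lemma binomial_sum_Suc:
  "binomial_sum b (Suc k) f = b * binomial_sum b k f + binomial_sum b k (\<lambda>i. f (Suc i))"
proof -
  have "b * binomial_sum b k f = (\<Sum>i\<le>Suc k. of_nat (k choose i) * b ^ (Suc k - i) * f i)"
    by (simp add: binomial_sum_def sum_distrib_left Suc_diff_le mult_ac)
  also have "\<dots> = b ^ Suc k * f 0 + (\<Sum>i\<le>k. of_nat (k choose Suc i) * b ^ (k - i) * f (Suc i))"
    by (subst sum.atMost_Suc_shift) simp
  finally show ?thesis
    unfolding binomial_sum_def
    by (subst sum.atMost_Suc_shift) (simp add: algebra_simps sum.distrib)
qed

lemma binomial_sum_prime_cong: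
  assumes "prime p"
  shows "[binomial_sum b p f = b ^ p * f 0 + f p] (mod int p)"
proof -
  have p: "p > 0" using assms by (simp add: prime_gt_0_nat)
  have "{..p} = insert 0 (insert p {0<..<p})" using p by auto
  then have "binomial_sum b p f
      = b ^ p * f 0 + f p + (\<Sum>i\<in>{0<..<p}. of_nat (p choose i) * b ^ (p - i) * f i)"
    using p by (simp add: binomial_sum_def)
  moreover have "int p dvd (\<Sum>i\<in>{0<..<p}. of_nat (p choose i) * b ^ (p - i) * f i)"
  proof (rule dvd_sum)
    fix i assume "i \<in> {0<..<p}"
    then have "p dvd p choose i" by (intro dvd_choose_prime) (use assms in auto)
    then show "int p dvd of_nat (p choose i) * b ^ (p - i) * f i"
      by (simp add: dvd_mult2)
  qed
  ultimately show ?thesis by (simp add: cong_iff_dvd_diff)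
qed

text \<open>Since 2 al = b + sqrt D, the even powers of sqrt D in (2 al)^k add up to half of 2^k
  v_k, and the odd ones to sqrt D times half of 2^k u_k.\<close>

lemma binomial_sum_companion:
  "2 ^ k * V b k = 2 * binomial_sum (int b) k (\<lambda>i. if even i then disc b ^ (i div 2) else 0) \<and>
   2 ^ k * U b k = 2 * binomial_sum (int b) k (\<lambda>i. if odd i then disc b ^ (i div 2) else 0)"
  (is "_ = 2 * binomial_sum _ k ?e \<and> _ = 2 * binomial_sum _ k ?o")
proof (induction k)
  case 0
  then show ?case by simp
next
  case (Suc k)
  have e: "(\<lambda>i. ?e (Suc i)) = (\<lambda>i. disc b * ?o i)" by (auto simp: fun_eq_iff elim!: oddE)
  have o: "(\<lambda>i. ?o (Suc i)) = ?e" by (auto simp: fun_eq_iff)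
  have scale: "binomial_sum c k (\<lambda>i. d * f i) = d * binomial_sum c k f" for c d f
    by (simp add: binomial_sum_def sum_distrib_left mult_ac)
  have v: "2 ^ Suc k * V b (Suc k) = int b * (2 ^ k * V b k) + disc b * (2 ^ k * U b k)"
    using arg_cong[OF companion_Suc[of b k], of "\<lambda>x. 2 ^ k * x"] by (simp add: algebra_simps)
  have u: "2 ^ Suc k * U b (Suc k) = int b * (2 ^ k * U b k) + 2 ^ k * V b k"
    using arg_cong[OF fundamental_Suc[of b k], of "\<lambda>x. 2 ^ k * x"] by (simp add: algebra_simps)
  show ?case
    unfolding u v Suc[THEN conjunct1] Suc[THEN conjunct2] binomial_sum_Suc e o scale
    by (simp add: algebra_simps)
qed

lemma fermat_power:
  assumes "prime p" shows "[int x ^ p = int x] (mod int p)"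
proof (cases "p dvd x")
  case True
  then have "p dvd x ^ p"
    using assms prime_gt_0_nat[of p] by (meson dvd_power dvd_trans)
  with True have "[x ^ p = x] (mod p)" by (simp add: cong_def)
  then show ?thesis by (simp flip: cong_int_iff)
next
  case False
  then have "[x ^ (p - 1) = 1] (mod p)" using fermat_theorem assms by blast
  then have "[x * x ^ (p - 1) = x * 1] (mod p)" by (rule cong_scalar_left)
  moreover have "x * x ^ (p - 1) = x ^ p"
    using prime_gt_0_nat[OF assms] by (simp flip: power_Suc)
  ultimately have "[x ^ p = x] (mod p)" by simp
  then show ?thesis by (simp flip: cong_int_iff)
qed

lemma cong_cancel_2:
  assumes "odd p" "[2 * x = 2 * y] (mod int p)" shows "[x = y] (mod int p)"
  using assms cong_mult_lcancel[of 2 "int p" x y] by auto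

text \<open>Modulo p only the terms i = 0 and i = p of the binomial sums survive, and Fermat
  replaces 2^p by 2 and b^p by b.\<close>

lemma companion_prime_cong:
  assumes "prime p" "odd p"
  shows "[V b p = int b] (mod int p)" "[U b p = disc b ^ ((p - 1) div 2)] (mod int p)"
proof -
  have p: "p > 0" using assms by (simp add: prime_gt_0_nat)
  have half: "p div 2 = (p - 1) div 2" using assms by (elim oddE) simp
  have "[2 * V b p = 2 ^ p * V b p] (mod int p)"
    using cong_sym[OF fermat_power[OF assms(1), of 2]] cong_scalar_right by simp
  also have "2 ^ p * V b p = 2 * binomial_sum (int b) p (\<lambda>i. if even i then disc b ^ (i div 2) else 0)"
    using binomial_sum_companion by blast
  also have "[\<dots> = 2 * (int b ^ p * 1 + 0)] (mod int p)"
    using cong_scalar_left[OF binomial_sum_prime_cong[OF assms(1)],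
        of 2 "int b" "\<lambda>i. if even i then disc b ^ (i div 2) else 0"] assms by simp
  also have "[2 * (int b ^ p * 1 + 0) = 2 * int b] (mod int p)"
    using cong_scalar_left[OF fermat_power[OF assms(1)]] by simp
  finally show "[V b p = int b] (mod int p)" by (rule cong_cancel_2[OF assms(2)])
  have "[2 * U b p = 2 ^ p * U b p] (mod int p)"
    using cong_sym[OF fermat_power[OF assms(1), of 2]] cong_scalar_right by simp
  also have "2 ^ p * U b p = 2 * binomial_sum (int b) p (\<lambda>i. if odd i then disc b ^ (i div 2) else 0)"
    using binomial_sum_companion by blast
  also have "[\<dots> = 2 * disc b ^ ((p - 1) div 2)] (mod int p)"
    using cong_scalar_left[OF binomial_sum_prime_cong[OF assms(1)],
        of 2 "int b" "\<lambda>i. if odd i then disc b ^ (i div 2) else 0"] assms half by simp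
  finally show "[U b p = disc b ^ ((p - 1) div 2)] (mod int p)" by (rule cong_cancel_2[OF assms(2)])
qed

text \<open>The Legendre symbol of D, in the form of Euler's criterion, selects the case: 2 u_(p-1)
  = v_p - b u_p and 2 u_(p+1) = v_p + b u_p, where modulo p the value v_p is b and u_p is 1 or
  -1.\<close>

lemma apparition:
  assumes "prime p" "odd p"
  shows "[disc b ^ ((p - 1) div 2) = 1] (mod int p) \<Longrightarrow> p dvd fundamental_seq b (p - 1)"
    and "[disc b ^ ((p - 1) div 2) = - 1] (mod int p) \<Longrightarrow> p dvd fundamental_seq b (p + 1)"
proof -
  have p: "p > 0" using assms by (simp add: prime_gt_0_nat)
  note c = companion_prime_cong[OF assms]
  { assume "[disc b ^ ((p - 1) div 2) = 1] (mod int p)"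
    then have "[U b p = 1] (mod int p)" using c(2) cong_trans by blast
    then have "[V b p - int b * U b p = int b - int b * 1] (mod int p)"
      by (intro cong_diff cong_scalar_left c(1))
    then have "[2 * U b (p - 1) = 2 * 0] (mod int p)"
      using fundamental_pred[of b "p - 1"] p by simp
    from cong_cancel_2[OF assms(2) this] show "p dvd fundamental_seq b (p - 1)"
      by (simp add: cong_0_iff)
  next
    assume "[disc b ^ ((p - 1) div 2) = - 1] (mod int p)"
    then have "[U b p = - 1] (mod int p)" using c(2) cong_trans by blast
    then have "[2 * U b (Suc p) = int b * (- 1) + int b] (mod int p)"
      unfolding fundamental_Suc by (intro cong_add cong_scalar_left c(1))
    then have "[2 * U b (Suc p) = 2 * 0] (mod int p)" by simp
    from cong_cancel_2[OF assms(2) this] show "p dvd fundamental_seq b (p + 1)"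
      by (simp add: cong_0_iff) }
qed

section \<open>Prime factors of v_n and the quadratic character of D\<close>

lemma odd_prime_not_dvd_both:
  assumes "prime p" "odd p" "p dvd companion_seq b n"
  shows "\<not> p dvd fundamental_seq b n"
proof
  assume u: "p dvd fundamental_seq b n"
  have "int p dvd V b n ^ 2 - disc b * U b n ^ 2"
    using u assms(3) by (intro dvd_diff dvd_mult) (auto simp: power2_eq_square)
  then have "int p dvd 4 * (-1) ^ n" by (simp add: norm_equation)
  then have "int p dvd 2 ^ 2" by (cases "even n") auto
  moreover have "prime (int p)" using assms by simp
  ultimately have "int p dvd 2" using prime_dvd_power_int by blast
  then have "p dvd 2" by presburger
  then have "p = 2" using assms(1) primes_dvd_imp_eq two_is_prime_nat by blast
  then show False using assms(2) by simp
qed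

text \<open>If p divides v_n, the norm equation reads D u_n^2 = 4 (-1)^(n+1) modulo p. Raising it to
  the power (p - 1) / 2 removes the squares u_n^2 and 4 by Fermat.\<close>

lemma companion_prime_residue:
  assumes "prime p" "odd p" "p dvd companion_seq b n"
  shows "[disc b ^ ((p - 1) div 2) = ((-1) ^ Suc n) ^ ((p - 1) div 2)] (mod int p)"
proof -
  define h where "h = (p - 1) div 2"
  have h: "2 * h = p - 1" using assms(2) by (simp add: h_def)
  have fermat: "[int x ^ (p - 1) = 1] (mod int p)" if "\<not> p dvd x" for x
    using fermat_theorem[OF assms(1) that] by (simp flip: cong_int_iff)
  have "int p dvd V b n ^ 2" using assms(3) by (auto simp: power2_eq_square)
  moreover have "disc b * U b n ^ 2 - 4 * (-1) ^ Suc n = V b n ^ 2"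
    using norm_equation[of b n] by simp
  ultimately have "[disc b * U b n ^ 2 = 4 * (-1) ^ Suc n] (mod int p)"
    by (simp only: cong_iff_dvd_diff)
  then have "[(disc b * U b n ^ 2) ^ h = (4 * (-1) ^ Suc n) ^ h] (mod int p)"
    by (rule cong_pow)
  then have eq: "[disc b ^ h * U b n ^ (p - 1) = 2 ^ (p - 1) * ((-1) ^ Suc n) ^ h] (mod int p)"
    unfolding h[symmetric] by (simp only: power_mult_distrib power_mult) simp
  have "[disc b ^ h * U b n ^ (p - 1) = disc b ^ h * 1] (mod int p)"
    using odd_prime_not_dvd_both[OF assms] by (intro cong_scalar_left fermat) auto
  moreover have "\<not> p dvd 2"
    using assms primes_dvd_imp_eq[of p 2] by auto
  then have "[2 ^ (p - 1) * ((-1) ^ Suc n) ^ h = 1 * ((-1) ^ Suc n) ^ h] (mod int p)"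
    using cong_scalar_right[OF fermat[of 2]] by (metis of_nat_numeral)
  ultimately have "[disc b ^ h * 1 = 1 * ((-1) ^ Suc n) ^ h] (mod int p)"
    using eq by (meson cong_sym cong_trans)
  then show ?thesis by (simp add: h_def)
qed

lemma companion_prime_rank_split:
  assumes "prime p" "odd p" "p dvd companion_seq b n" "odd n \<or> p mod 4 = 1"
  shows "p dvd fundamental_seq b (p - 1)"
proof (rule apparition(1)[OF assms(1,2)])
  have "p mod 4 = 1 \<Longrightarrow> even ((p - 1) div 2)" by presburger
  then have "((-1) ^ Suc n) ^ ((p - 1) div 2) = (1 :: int)"
    using assms(4) by (cases "odd n") auto
  then show "[disc b ^ ((p - 1) div 2) = 1] (mod int p)"
    using companion_prime_residue[OF assms(1-3)] by simp
qed

lemma companion_prime_rank_inert: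
  assumes "prime p" "odd p" "p dvd companion_seq b n" "even n" "p mod 4 = 3"
  shows "p dvd fundamental_seq b (p + 1)"
proof (rule apparition(2)[OF assms(1,2)])
  have "odd ((p - 1) div 2)" using assms(5) by presburger
  then have "((-1) ^ Suc n) ^ ((p - 1) div 2) = (- 1 :: int)" using assms(4) by auto
  then show "[disc b ^ ((p - 1) div 2) = - 1] (mod int p)"
    using companion_prime_residue[OF assms(1-3)] by simp
qed

text \<open>For g = gcd(k, 2n), p divides u_g. If g were a proper divisor of 2n, it would divide 2n
  / r for a prime r. For r = 2 this puts p into u_n, against the norm equation; for odd r it puts p
  into u_(n/r) or v_(n/r), the second being excluded by \<open>primitive\<close>.\<close>

lemma dvd_fundamental_imp_dvd:
  assumes p: "prime p" "odd p" "p dvd companion_seq b n" and n: "n > 0"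
    and primitive: "\<And>r. prime r \<Longrightarrow> odd r \<Longrightarrow> r dvd n \<Longrightarrow> \<not> p dvd companion_seq b (n div r)"
    and k: "p dvd fundamental_seq b k"
  shows "2 * n dvd k"
proof -
  have not_u: "\<not> p dvd fundamental_seq b m" if "m dvd n" for m
    using odd_prime_not_dvd_both[OF p] fundamental_dvd[OF that] dvd_trans by blast
  define g where "g = gcd k (2 * n)"
  have u: "p dvd fundamental_seq b g"
    using k p(3) by (simp add: g_def fundamental_double_nat flip: gcd_fundamental)
  have "g dvd 2 * n" by (simp add: g_def)
  then obtain c where c: "2 * n = g * c" by blast
  have "c = 1"
  proof (rule ccontr)
    assume "c \<noteq> 1"
    then obtain r where r: "prime r" "r dvd c" using prime_factor_nat by blast
    then obtain d where d: "2 * n = r * (g * d)" using c by auto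
    show False
    proof (cases "r = 2")
      case True
      then show False using d u not_u[of g] by simp
    next
      case False
      then have odd: "odd r" using r(1) primes_dvd_imp_eq two_is_prime_nat by blast
      then have "coprime r 2" by simp
      moreover have "r dvd 2 * n" using d by simp
      ultimately have rn: "r dvd n" by (simp add: coprime_dvd_mult_right_iff)
      then have n': "n = r * (n div r)" by simp
      then have "2 * (n div r) = g * d"
        using d prime_gt_0_nat[OF r(1)] by (metis mult.left_commute mult_cancel1 not_gr_zero)
      then have "p dvd fundamental_seq b (2 * (n div r))"
        using u fundamental_dvd[of g "2 * (n div r)"] dvd_trans by auto
      then have "p dvd fundamental_seq b (n div r) \<or> p dvd companion_seq b (n div r)"
        using p(1) by (simp add: fundamental_double_nat prime_dvd_mult_iff)
      then show False using primitive[OF r(1) odd rn] not_u[of "n div r"] n' by (metis dvd_triv_right)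
    qed
  qed
  then show ?thesis using c by (metis g_def gcd_dvd1 mult.right_neutral)
qed

subsection \<open>Totients without large prime factors\<close>

text \<open>For positive k this means k = 2^x 3^y; stated through prime factors, it passes to
  divisors at once.\<close>

definition smooth :: "nat \<Rightarrow> bool" where
  "smooth k \<longleftrightarrow> (\<forall>p. prime p \<longrightarrow> p dvd k \<longrightarrow> p \<le> 3)"

lemma smooth_dvd: "smooth k \<Longrightarrow> d dvd k \<Longrightarrow> smooth d"
  unfolding smooth_def using dvd_trans by blast

lemma prime_le_3_iff: "prime p \<and> p \<le> 3 \<longleftrightarrow> p = 2 \<or> p = (3 :: nat)"
proof
  assume "prime p \<and> p \<le> 3"
  moreover from this have "p \<ge> 2" by (simp add: prime_ge_2_nat)
  ultimately show "p = 2 \<or> p = 3" by linarith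
qed auto

lemma smooth_2_power_3_power: "smooth (2 ^ x * 3 ^ y)"
  unfolding smooth_def
proof (intro allI impI)
  fix p :: nat assume p: "prime p" "p dvd 2 ^ x * 3 ^ y"
  then have "p dvd 2 ^ x \<or> p dvd 3 ^ y" by (simp add: prime_dvd_mult_iff)
  then have "p dvd 2 \<or> p dvd 3" using p(1) prime_dvd_power by blast
  then show "p \<le> 3" using dvd_imp_le[of p 2] dvd_imp_le[of p 3] by auto
qed

lemma smooth_imp_power_form:
  assumes "smooth k" "k > 0" shows "\<exists>x y. k = 2 ^ x * 3 ^ y"
  using assms
proof (induction k rule: less_induct)
  case (less k)
  show ?case
  proof (cases "k = 1")
    case True
    then have "k = 2 ^ 0 * 3 ^ 0" by simp
    then show ?thesis by blast
  next
    case False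
    then obtain p where p: "prime p" "p dvd k" using prime_factor_nat by blast
    then have p23: "p = 2 \<or> p = 3" using less.prems(1) prime_le_3_iff by (auto simp: smooth_def)
    obtain d where d: "k = p * d" using p(2) by blast
    then have "d < k" "d > 0" using less.prems(2) p23 by auto
    moreover have "smooth d" using smooth_dvd[OF less.prems(1)] d by simp
    ultimately obtain x y where "d = 2 ^ x * 3 ^ y" using less.IH by blast
    then have "k = 2 ^ Suc x * 3 ^ y \<or> k = 2 ^ x * 3 ^ Suc y" using d p23 by auto
    then show ?thesis by blast
  qed
qed

lemma power_form_unique:
  "(2 :: nat) ^ x * 3 ^ y = 2 ^ c * 3 ^ d \<longleftrightarrow> x = c \<and> y = d"
proof
  assume eq: "(2 :: nat) ^ x * 3 ^ y = 2 ^ c * 3 ^ d"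
  have mult: "multiplicity p (2 ^ x * 3 ^ y :: nat) = x * multiplicity p 2 + y * multiplicity p 3"
    if "prime p" for p x y
    using that by (simp add: prime_elem_multiplicity_mult_distrib prime_elem_multiplicity_power_distrib)
  have "\<not> 2 dvd (3 :: nat)" "\<not> 3 dvd (2 :: nat)" by simp_all
  then have "multiplicity 2 (3 :: nat) = 0" "multiplicity 3 (2 :: nat) = 0"
    by (simp_all add: not_dvd_imp_multiplicity_0)
  then show "x = c \<and> y = d"
    using mult[of 2 x y] mult[of 2 c d] mult[of 3 x y] mult[of 3 c d] eq by simp
qed simp

lemma smooth_totient_prime_factor:
  assumes "smooth (totient N)" "prime p" "p dvd N"
  shows "smooth (p - 1)"
  using smooth_dvd[OF assms(1) totient_dvd[OF assms(3)]] assms(2) by (simp add: totient_prime)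

lemma smooth_totient_dvd: "smooth (totient N) \<Longrightarrow> d dvd N \<Longrightarrow> smooth (totient d)"
  using smooth_dvd totient_dvd by blast

text \<open>A square p^2 dividing N puts p itself into the totient of N.\<close>

lemma smooth_totient_square_factor:
  assumes "smooth (totient N)" "prime p" "p * p dvd N"
  shows "p \<le> 3"
proof -
  have "totient (p * p) = p * (p - 1)"
    using totient_prime_power[OF assms(2), of 2] by (simp add: power2_eq_square)
  then have "smooth (p * (p - 1))" using smooth_totient_dvd[OF assms(1,3)] by simp
  then show ?thesis using assms(2) by (simp add: smooth_def)
qed

text \<open>Here p - 1 is 2 modulo 4, so the factor 2 occurs in it exactly once.\<close>

lemma smooth_pred_inert_prime:
  assumes "prime p" "smooth (p - 1)" "p mod 4 = 3"
  shows "\<exists>j. p = 2 * 3 ^ j + 1"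
proof -
  have "p - 1 > 0" using prime_gt_1_nat[OF assms(1)] by simp
  from smooth_imp_power_form[OF assms(2) this]
  obtain x y where xy: "p - 1 = 2 ^ x * 3 ^ y" by blast
  define r where "r = p div 4"
  have "p = 4 * r + 3" using assms(3) mult_div_mod_eq[of 4 p] by (simp add: r_def)
  then have "p - 1 = 4 * r + 2" by simp
  then have eq: "2 ^ x * 3 ^ y = 2 * (2 * r + 1)" using xy by simp
  have "x = 1"
  proof (cases x)
    case 0
    then have "odd (2 ^ x * 3 ^ y :: nat)" by simp
    then show ?thesis unfolding eq by simp
  next
    case (Suc i)
    then have "2 ^ i * 3 ^ y = 2 * r + 1" using eq by simp
    then have "odd (2 ^ i * 3 ^ y :: nat)" by simp
    then show ?thesis using Suc by (cases i) auto
  qed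
  then have "p = 2 * 3 ^ y + 1" using xy prime_gt_1_nat[OF assms(1)] by simp
  then show ?thesis by blast
qed

lemma cong_1_if_prime_factors_cong_1:
  fixes N m :: nat
  assumes "N > 0" "\<And>p. prime p \<Longrightarrow> p dvd N \<Longrightarrow> [p = 1] (mod m)"
  shows "[N = 1] (mod m)"
  using assms
proof (induction N rule: less_induct)
  case (less N)
  show ?case
  proof (cases "N = 1")
    case False
    then obtain p where p: "prime p" "p dvd N" using prime_factor_nat by blast
    then obtain d where d: "N = p * d" by blast
    then have "d < N" "d > 0" using less.prems(1) prime_gt_1_nat[OF p(1)] by auto
    then have "[d = 1] (mod m)" using less.IH[of d] less.prems(2) d by simp
    then have "[p * d = 1 * 1] (mod m)" using less.prems(2)[OF p] cong_mult by blast
    then show ?thesis by (simp add: d)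
  qed simp
qed

lemma prime_factor_3_mod_4:
  fixes N :: nat
  assumes "N mod 4 = 3"
  shows "\<exists>p. prime p \<and> p dvd N \<and> p mod 4 = 3"
proof (rule ccontr)
  assume *: "\<not> ?thesis"
  have "[p = 1] (mod 4)" if "prime p" "p dvd N" for p
  proof -
    have "odd N" using assms by presburger
    then have "odd p" using that(2) dvd_trans by blast
    moreover have "p mod 4 \<noteq> 3" using * that by blast
    ultimately show ?thesis unfolding cong_def by presburger
  qed
  moreover have "N > 0" using assms by (intro Nat.gr0I) simp
  ultimately have "[N = 1] (mod 4)" using cong_1_if_prime_factors_cong_1 by simp
  then show False using assms by (simp add: cong_def)
qed

lemma not_8_dvd_3_power_plus_1: "\<not> 8 dvd (3 :: nat) ^ j + 1"
proof -
  have "(3 :: nat) ^ j mod 8 = 1 \<or> (3 :: nat) ^ j mod 8 = 3"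
  proof (induction j)
    case (Suc j)
    have "(3 :: nat) ^ Suc j mod 8 = 3 * (3 ^ j mod 8) mod 8" by (simp add: mod_mult_right_eq)
    with Suc show ?case by auto
  qed simp
  then show ?thesis by presburger
qed

lemma not_3_dvd_2_power: "\<not> 3 dvd (2 :: nat) ^ i"
proof
  assume "3 dvd (2 :: nat) ^ i"
  then have "3 dvd (2 :: nat)" using prime_dvd_power[of "3 :: nat" 2 i] by simp
  then show False by simp
qed

section \<open>Growth and parity of v, and indices that are powers of 2\<close>

lemma companion_pos: "b > 0 \<Longrightarrow> companion_seq b n > 0"
  by (induction b n rule: companion_seq.induct) auto

text \<open>Index 0 is left out: v_0 = 2 exceeds v_1 = 1 when b = 1.\<close>

lemma companion_strict_mono:
  assumes "b > 0" "0 < m" "m < n" shows "companion_seq b m < companion_seq b n"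
proof -
  have step: "companion_seq b (Suc k) < companion_seq b (Suc (Suc k))" for k
  proof -
    have "1 * companion_seq b (Suc k) \<le> b * companion_seq b (Suc k)"
      using assms(1) by (intro mult_right_mono) auto
    then show ?thesis using companion_pos[OF assms(1), of k]
      unfolding companion_seq.simps by linarith
  qed
  obtain i j where "m = Suc i" "n = Suc j"
    using assms(2,3) by (metis gr0_implies_Suc less_trans)
  then show ?thesis
    using lift_Suc_mono_less[of "\<lambda>k. companion_seq b (Suc k)", OF step] assms(3) by simp
qed

lemma even_companion_iff:
  assumes "odd b" shows "even (companion_seq b n) \<longleftrightarrow> 3 dvd n"
  using assms
proof (induction b n rule: companion_seq.induct)
  case (3 b n)
  have *: "\<not> (3 dvd n \<and> 3 dvd Suc n)" by presburger
  have "even (companion_seq b (Suc (Suc n))) \<longleftrightarrow> (3 dvd Suc n \<longleftrightarrow> 3 dvd n)"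
    using 3 by auto
  also have "\<dots> \<longleftrightarrow> 3 dvd Suc (Suc n)" by presburger
  finally show ?case .
qed auto

text \<open>A prime factor p has rank 2^(a+1). If p = 1 mod 4, the rank divides p - 1, so p = 1 mod
  8. If p = 3 mod 4, then p = 2 * 3^j + 1 and 2^a divides 3^j + 1, impossible modulo 8. Hence
  v_(2^a) would be 1 mod 8, whereas it is an odd square minus 2.\<close>

lemma companion_two_power_not_smooth:
  assumes b: "odd b" and a: "a \<ge> 3"
  shows "\<not> smooth (totient (companion_seq b (2 ^ a)))"
proof
  let ?v = "companion_seq b"
  assume sm: "smooth (totient (?v (2 ^ a)))"
  have odd: "odd (?v (2 ^ i))" for i
    using even_companion_iff[OF b] not_3_dvd_2_power by blast
  \<comment> \<open>Vacuously true: no odd prime divides a power of 2.\<close>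
  have primitive: "\<And>r. prime r \<Longrightarrow> odd r \<Longrightarrow> r dvd 2 ^ a \<Longrightarrow> \<not> p dvd ?v (2 ^ a div r)" for p
    using prime_dvd_power primes_dvd_imp_eq two_is_prime_nat by blast
  have "8 dvd (2 :: nat) ^ a" using le_imp_power_dvd[OF a, of "2 :: nat"] by simp
  have "[p = 1] (mod 8)" if p: "prime p" "p dvd ?v (2 ^ a)" for p
  proof -
    have "odd p" using p(2) odd[of a] dvd_trans by blast
    note rank = dvd_fundamental_imp_dvd[OF p(1) this p(2) _ primitive, simplified]
    have "p mod 4 = 1 \<or> p mod 4 = 3" using \<open>odd p\<close> by presburger
    then show ?thesis
    proof
      assume "p mod 4 = 1"
      then have "2 * 2 ^ a dvd p - 1"
        using rank companion_prime_rank_split[OF p(1) \<open>odd p\<close> p(2)] by simp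
      then have "8 dvd p - 1" using \<open>8 dvd 2 ^ a\<close> by (meson dvd_mult dvd_trans)
      then show ?thesis using prime_gt_1_nat[OF p(1)] by (simp add: cong_altdef_nat)
    next
      assume p3: "p mod 4 = 3"
      have "even ((2 :: nat) ^ a)" using a by simp
      then have "2 * 2 ^ a dvd p + 1"
        using rank companion_prime_rank_inert[OF p(1) \<open>odd p\<close> p(2) _ p3] by simp
      moreover obtain j where "p = 2 * 3 ^ j + 1"
        using smooth_pred_inert_prime[OF p(1) smooth_totient_prime_factor[OF sm p] p3] by blast
      ultimately have "2 * 2 ^ a dvd 2 * ((3 :: nat) ^ j + 1)" by simp
      then have "2 ^ a dvd (3 :: nat) ^ j + 1" by (metis dvd_times_left_cancel_iff zero_neq_numeral)
      then have "8 dvd (3 :: nat) ^ j + 1" using \<open>8 dvd 2 ^ a\<close> dvd_trans by blast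
      then show ?thesis using not_8_dvd_3_power_plus_1 by blast
    qed
  qed
  moreover have "?v (2 ^ a) > 0" using odd[of a] by (rule odd_pos)
  ultimately have "[?v (2 ^ a) = 1] (mod 8)" using cong_1_if_prime_factors_cong_1[of "?v (2 ^ a)" 8] by blast
  then have "[V b (2 ^ a) = 1] (mod 8)" by (simp flip: cong_int_iff)
  moreover have "[V b (2 ^ a) = - 1] (mod 8)"
  proof -
    obtain i where i: "a = Suc i" "i > 0" using a by (cases a) auto
    then have "even ((2 :: nat) ^ i)" by simp
    then have "V b (2 ^ a) = V b (2 ^ i) ^ 2 - 2"
      using companion_double[of b "2 ^ i"] i by simp
    moreover have "[companion_seq b (2 ^ i) ^ 2 = 1] (mod 8)"
      using odd[of i] square_mod_8_eq_1_iff by blast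
    then have "[V b (2 ^ i) ^ 2 = 1] (mod 8)" by (simp flip: cong_int_iff)
    then have "[V b (2 ^ i) ^ 2 - 2 = 1 - 2] (mod 8)" by (intro cong_diff) auto
    ultimately show ?thesis by simp
  qed
  ultimately have "[1 = - 1 :: int] (mod 8)" using cong_sym cong_trans by blast
  then show False by (simp add: cong_def)
qed

subsection \<open>Prime factors of the index\<close>

text \<open>By \<open>companion_odd_mult\<close> the quotient is plus or minus k modulo v_m, hence
  modulo p.\<close>

lemma companion_quotient_common_factor:
  assumes "b > 0" "odd k" "companion_seq b (m * k) = companion_seq b m * R"
    and p: "p dvd companion_seq b m" "p dvd R"
  shows "p dvd k"
proof -
  obtain j where j: "k = 2 * j + 1" using assms(2) by (elim oddE)
  obtain S where S: "V b (m * k) = V b m * S"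
    "[S = (- ((-1) ^ m)) ^ j * (2 * int j + 1)] (mod V b m)"
    using companion_odd_mult[of b m j] unfolding j by blast
  have "V b m * S = V b m * int R" by (metis S(1) assms(3) of_nat_mult)
  moreover have "V b m \<noteq> 0" using companion_pos[OF assms(1), of m] by simp
  ultimately have "S = int R" by (metis mult_left_cancel)
  moreover have "[S = (- ((-1) ^ m)) ^ j * int k] (mod int p)"
    using cong_dvd_modulus[OF S(2)] p(1) j by (simp add: add.commute)
  ultimately have "int p dvd (- ((-1) ^ m)) ^ j * int k"
    using p(2) cong_dvd_iff by fastforce
  moreover have "(- ((-1) ^ m)) ^ j = (1 :: int) \<or> (- ((-1) ^ m)) ^ j = (- 1 :: int)"
    by (cases "even m"; cases "even j") auto
  ultimately have "int p dvd int k" by auto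
  then show ?thesis by simp
qed

lemma prime_greater_3_not_dvd:
  assumes "prime q" "q > (3 :: nat)" shows "odd q" "\<not> 3 dvd q"
proof -
  show "odd q" using assms primes_dvd_imp_eq[of 2 q] two_is_prime_nat by auto
  have "prime (3 :: nat)" by simp
  then show "\<not> 3 dvd q" using assms primes_dvd_imp_eq[of 3 q] by auto
qed

text \<open>A prime dividing both v_(2^a) and the quotient would be q, and then q^2 would divide
  v_(2^a q), putting q > 3 into its totient. So p is new at the index 2^a q, whose only odd prime
  factor is q, and \<open>dvd_fundamental_imp_dvd\<close> applies.\<close>

lemma quotient_prime_factor:
  assumes b: "odd b" and q: "prime q" "q > 3"
    and sm: "smooth (totient (companion_seq b (2 ^ a * q)))"
    and R: "companion_seq b (2 ^ a * q) = companion_seq b (2 ^ a) * R"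
    and p: "prime p" "p dvd R"
  shows "odd p" "p dvd companion_seq b (2 ^ a * q)" "smooth (p - 1)"
    and "p dvd fundamental_seq b k \<Longrightarrow> 2 * (2 ^ a * q) dvd k"
proof -
  let ?v = "companion_seq b"
  have "odd q" "\<not> 3 dvd q" using prime_greater_3_not_dvd[OF q] by auto
  \<comment> \<open>The index is not divisible by 3, so this value of v is odd and p = 2 cannot
    occur.\<close>
  have "prime (3 :: nat)" by simp
  then have "\<not> 3 dvd 2 ^ a * q"
    using \<open>\<not> 3 dvd q\<close> not_3_dvd_2_power prime_dvd_mult_iff by blast
  then have odd: "odd (?v (2 ^ a * q))" using even_companion_iff[OF b] by blast
  show pv: "p dvd ?v (2 ^ a * q)" using p(2) R by simp
  show "odd p" using pv odd dvd_trans by blast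
  show "smooth (p - 1)" using smooth_totient_prime_factor[OF sm p(1) pv] .
  have p_new: "\<not> p dvd ?v (2 ^ a)"
  proof
    assume p_old: "p dvd ?v (2 ^ a)"
    have "b > 0" using b by (rule odd_pos)
    from companion_quotient_common_factor[OF this \<open>odd q\<close> R p_old p(2)]
    have "p = q" using p(1) q(1) primes_dvd_imp_eq by blast
    moreover have "p * p dvd ?v (2 ^ a * q)" unfolding R using p_old p(2) by (rule mult_dvd_mono)
    ultimately show False using smooth_totient_square_factor[OF sm p(1)] q(2) by simp
  qed
  show "2 * (2 ^ a * q) dvd k" if "p dvd fundamental_seq b k"
  proof (rule dvd_fundamental_imp_dvd[OF p(1) \<open>odd p\<close> pv _ _ that])
    show "0 < 2 ^ a * q" using q(2) by simp
    fix r assume r: "prime r" "odd r" "r dvd 2 ^ a * q"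
    have "\<not> r dvd 2 ^ a"
      using r(1,2) prime_dvd_power primes_dvd_imp_eq two_is_prime_nat by blast
    then have "r dvd q" using r(1,3) prime_dvd_mult_iff by blast
    then have "r = q" using r(1) q(1) primes_dvd_imp_eq by blast
    then show "\<not> p dvd ?v (2 ^ a * q div r)" using p_new q(2) by simp
  qed
qed

text \<open>If the index were odd or p = 1 mod 4, then q would divide p - 1, which has no prime
  factor above 3. So the index is even and p = 3 mod 4; then p = 2 * 3^j + 1, and 2^(a+1) q divides
  p + 1 = 2 (3^j + 1).\<close>

lemma quotient_prime_factor_inert:
  assumes b: "odd b" and q: "prime q" "q > 3"
    and sm: "smooth (totient (companion_seq b (2 ^ a * q)))"
    and R: "companion_seq b (2 ^ a * q) = companion_seq b (2 ^ a) * R"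
    and p: "prime p" "p dvd R"
  shows "a > 0" and "\<exists>j. p = 2 * 3 ^ j + 1 \<and> 2 ^ a * q dvd 3 ^ j + 1"
proof -
  note facts = quotient_prime_factor[OF assms]
  have not_split: "\<not> (odd (2 ^ a * q) \<or> p mod 4 = 1)"
  proof
    assume "odd (2 ^ a * q) \<or> p mod 4 = 1"
    then have "p dvd fundamental_seq b (p - 1)"
      using companion_prime_rank_split[OF p(1) facts(1,2)] by blast
    then have "2 * (2 ^ a * q) dvd p - 1" by (rule facts(4))
    then have "q dvd p - 1" by (meson dvd_mult_right)
    then show False using facts(3) q by (auto simp: smooth_def)
  qed
  then show "a > 0" using prime_greater_3_not_dvd(1)[OF q] by (cases a) auto
  have even: "even (2 ^ a * q)" using not_split by blast
  have p3: "p mod 4 = 3" using facts(1) not_split by presburger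
  obtain j where j: "p = 2 * 3 ^ j + 1" using smooth_pred_inert_prime[OF p(1) facts(3) p3] by blast
  have "2 * (2 ^ a * q) dvd p + 1"
    using facts(4) companion_prime_rank_inert[OF p(1) facts(1,2) even p3] by blast
  also have "p + 1 = 2 * (3 ^ j + 1)" using j by simp
  finally have "2 ^ a * q dvd 3 ^ j + 1" by (metis dvd_times_left_cancel_iff zero_neq_numeral)
  with j show "\<exists>j. p = 2 * 3 ^ j + 1 \<and> 2 ^ a * q dvd 3 ^ j + 1" by blast
qed

text \<open>The smallest prime factor of the quotient supplies the exponent \<open>j\<close>: all its other prime
  factors are congruent to 1 modulo \<open>3 ^ j\<close> as well.\<close>

lemma smooth_totient_multiple_imp:
  assumes b: "odd b" and q: "prime q" "q > 3"
    and sm: "smooth (totient (companion_seq b (2 ^ a * q)))"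
  shows "a > 0" and "\<exists>j. prime (2 * 3 ^ j + 1 :: nat) \<and> 2 ^ a * q dvd 3 ^ j + 1 \<and>
    3 ^ j * V b (2 ^ a) dvd V b (2 ^ a * q) - V b (2 ^ a)"
proof -
  let ?v = "companion_seq b"
  have "odd q" using prime_greater_3_not_dvd[OF q] by auto
  have bpos: "b > 0" using b by (rule odd_pos)
  obtain R where R: "?v (2 ^ a * q) = ?v (2 ^ a) * R"
    using companion_dvd_odd_mult[OF \<open>odd q\<close>, of b "2 ^ a"] by blast
  note inert = quotient_prime_factor_inert[OF b q sm R]
  \<comment> \<open>Strict growth of v gives R > 1, so R has a prime factor at all.\<close>
  have "2 ^ a * 1 < 2 ^ a * q" using q(2) by (intro mult_strict_left_mono) auto
  then have "?v (2 ^ a) < ?v (2 ^ a * q)" using companion_strict_mono[OF bpos] by simp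
  then have "R \<noteq> 1" "R > 0" unfolding R using companion_pos[OF bpos, of "2 ^ a"]
    by (auto intro: Nat.gr0I)
  then obtain p0 where p0: "prime p0 \<and> p0 dvd R" using prime_factor_nat by blast
  show "a > 0" using p0 inert(1) by blast
  define p where "p = (LEAST p. prime p \<and> p dvd R)"
  have p: "prime p" "p dvd R" using LeastI[of "\<lambda>p. prime p \<and> p dvd R", OF p0] by (auto simp: p_def)
  obtain j where j: "p = 2 * 3 ^ j + 1" "2 ^ a * q dvd 3 ^ j + 1" using inert(2)[OF p] by blast
  have "[r = 1] (mod 3 ^ j)" if r: "prime r" "r dvd R" for r
  proof -
    obtain i where i: "r = 2 * 3 ^ i + 1" using inert(2)[OF r] by blast
    have "p \<le> r" unfolding p_def using r by (intro Least_le) auto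
    then have "(3 :: nat) ^ j \<le> 3 ^ i" using i j(1) by simp
    then have "j \<le> i" by simp
    then have "(3 :: nat) ^ j dvd 2 * 3 ^ i" by (simp add: le_imp_power_dvd)
    then show ?thesis unfolding i by (simp add: cong_altdef_nat)
  qed
  then have "[R = 1] (mod 3 ^ j)" using cong_1_if_prime_factors_cong_1[OF \<open>R > 0\<close>] by blast
  then have "[int R = 1] (mod 3 ^ j)" by (simp flip: cong_int_iff)
  then have "3 ^ j dvd int R - 1" by (simp add: cong_iff_dvd_diff)
  \<comment> \<open>The factor v_(2^a) is kept because for a = 1 its own power of 3 is needed in
    \<open>not_smooth_totient_double_prime\<close>.\<close>
  then have "3 ^ j * V b (2 ^ a) dvd (int R - 1) * V b (2 ^ a)" by (rule mult_dvd_mono) simp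
  moreover have "(int R - 1) * V b (2 ^ a) = V b (2 ^ a * q) - V b (2 ^ a)"
    unfolding R by (simp add: algebra_simps)
  ultimately show "\<exists>j. prime (2 * 3 ^ j + 1 :: nat) \<and> 2 ^ a * q dvd 3 ^ j + 1 \<and>
      3 ^ j * V b (2 ^ a) dvd V b (2 ^ a * q) - V b (2 ^ a)"
    using j p(1) by metis
qed

section \<open>The 3-adic valuation of u\<close>

lemma companion_diff_odd_multiple:
  assumes "odd q"
  shows "V b (2 ^ Suc i * q) - V b (2 ^ Suc i)
    = disc b * (U b (2 ^ i * (q + 1)) * U b (2 ^ i * (q - 1)))"
proof -
  obtain d where d: "q = Suc d" "even d" using assms by (cases q) auto
  have "2 ^ Suc i + 2 * (2 ^ i * d) = 2 ^ Suc i * q" "2 ^ Suc i + 2 ^ i * d = 2 ^ i * (q + 1)"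
    unfolding d(1) by (simp_all add: algebra_simps)
  \<comment> \<open>The shift m = 2^i (q - 1) is even, so the sign in \<open>companion_diff\<close>
    is +1.\<close>
  then show ?thesis
    using companion_diff[of b "2 ^ Suc i" "2 ^ i * d"] d by (simp only:) (simp add: mult.assoc)
qed

text \<open>The gcd of k and r is a power of 2 at which 3 divides u, and a proper divisor of r would
  divide r / 2. The number r is the rank of 3, which is 2 if 3 divides b and 4 otherwise.\<close>

lemma three_dvd_fundamental_imp_rank_dvd:
  assumes r: "r = 2 ^ s" "s > 0" "3 dvd fundamental_seq b r" "\<not> 3 dvd fundamental_seq b (r div 2)"
    and k: "3 dvd fundamental_seq b k"
  shows "r dvd k"
proof -
  have u: "3 dvd fundamental_seq b (gcd k r)" using r(3) k by (simp flip: gcd_fundamental)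
  obtain i where i: "i \<le> s" "gcd k r = 2 ^ i"
    using divides_primepow_nat[of 2 "gcd k r" s] r(1) by auto
  have "i = s"
  proof (rule ccontr)
    assume "i \<noteq> s"
    then have "i \<le> s - 1" using i(1) by simp
    then have "gcd k r dvd 2 ^ (s - 1)" unfolding i(2) by (rule le_imp_power_dvd)
    also have "2 ^ (s - 1) = r div 2" using r(1,2) by (cases s) auto
    finally show False using u r(4) fundamental_dvd dvd_trans by blast
  qed
  then show ?thesis using i(2) r(1) by (metis gcd_dvd1)
qed

text \<open>Lifting the exponent: u_(3n) = u_n (D u_n^2 + 3) for even n, and since 3 divides u_n the
  second factor is 3 modulo 9. Each tripling of the index adds exactly one factor 3.\<close>

lemma three_power_dvd_fundamental:
  assumes r: "r = 2 ^ s" "s > 0"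
    and e: "e > 0" "3 ^ e dvd fundamental_seq b r" "\<not> 3 ^ Suc e dvd fundamental_seq b r"
  shows "3 ^ (e + t) dvd fundamental_seq b (r * 3 ^ t)
    \<and> \<not> 3 ^ Suc (e + t) dvd fundamental_seq b (r * 3 ^ t)"
proof (induction t)
  case 0
  then show ?case using e by simp
next
  case (Suc t)
  let ?n = "r * 3 ^ t"
  let ?u = "fundamental_seq b ?n"
  obtain w where w: "?u = 3 ^ (e + t) * w" using Suc by blast
  have w3: "\<not> 3 dvd w"
  proof
    assume "3 dvd w"
    then have "3 ^ (e + t) * 3 dvd ?u" unfolding w by simp
    then show False using Suc by (simp add: mult.commute)
  qed
  obtain z where z: "?u = 3 * z" using w e(1) by (cases e) auto
  have even: "even ?n" using r by simp
  have "int (fundamental_seq b (3 * ?n)) = int (?u * ((b ^ 2 + 4) * ?u ^ 2 + 3))"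
    unfolding fundamental_triple[OF even] by simp
  then have "fundamental_seq b (3 * ?n) = ?u * ((b ^ 2 + 4) * ?u ^ 2 + 3)"
    using of_nat_eq_iff by blast
  also have "(b ^ 2 + 4) * ?u ^ 2 + 3 = 3 * (3 * ((b ^ 2 + 4) * z ^ 2) + 1)"
    unfolding z by (simp add: power2_eq_square)
  also have "?u * (3 * (3 * ((b ^ 2 + 4) * z ^ 2) + 1))
      = 3 ^ (e + Suc t) * (w * (3 * ((b ^ 2 + 4) * z ^ 2) + 1))"
    unfolding w by (simp only: add_Suc_right power_Suc mult_ac)
  also have "3 * ?n = r * 3 ^ Suc t" by simp
  finally have eq: "fundamental_seq b (r * 3 ^ Suc t)
      = 3 ^ (e + Suc t) * (w * (3 * ((b ^ 2 + 4) * z ^ 2) + 1))" .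
  define c where "c = w * (3 * ((b ^ 2 + 4) * z ^ 2) + 1)"
  have "prime (3 :: nat)" by simp
  moreover have "\<not> 3 dvd 3 * ((b ^ 2 + 4) * z ^ 2) + 1" by presburger
  ultimately have "\<not> 3 dvd c"
    unfolding c_def using w3 prime_dvd_mult_iff by blast
  moreover have "3 ^ Suc (e + Suc t) = 3 ^ (e + Suc t) * (3 :: nat)" by simp
  ultimately show ?case
    unfolding eq c_def[symmetric] by (metis dvd_times_left_cancel_iff dvd_triv_left power_not_zero zero_neq_numeral)
qed

text \<open>If 3^t did not divide k, the gcd of k and r 3^t would divide r 3^i for some i < t, and
  there the valuation of u is only e + i.\<close>

lemma three_power_dvd_fundamental_imp:
  assumes r: "r = 2 ^ s" "s > 0" "\<not> 3 dvd fundamental_seq b (r div 2)"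
    and e: "e > 0" "3 ^ e dvd fundamental_seq b r" "\<not> 3 ^ Suc e dvd fundamental_seq b r"
    and k: "3 ^ (e + t) dvd fundamental_seq b k"
  shows "r * 3 ^ t dvd k"
proof -
  note exact = three_power_dvd_fundamental[OF r(1,2) e]
  have dvd3: "3 dvd x" if "3 ^ (e + i) dvd x" for x i :: nat
  proof -
    have "(3 :: nat) dvd 3 ^ (e + i)" using e(1) by (cases e) auto
    then show ?thesis using that dvd_trans by blast
  qed
  have "r dvd k"
    using three_dvd_fundamental_imp_rank_dvd[OF r(1,2) _ r(3)] dvd3[OF k] dvd3[of 0] e(2) by simp
  have u: "3 ^ (e + t) dvd fundamental_seq b (gcd k (r * 3 ^ t))"
    using k exact[of t] by (simp flip: gcd_fundamental)
  have "3 ^ t dvd k"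
  proof (rule ccontr)
    assume "\<not> 3 ^ t dvd k"
    obtain i where i: "i \<le> t" "gcd k (3 ^ t) = 3 ^ i"
      using divides_primepow_nat[of 3 "gcd k (3 ^ t)" t] by auto
    then have "i \<noteq> t" using \<open>\<not> 3 ^ t dvd k\<close> by (metis gcd_dvd1)
    then have "Suc i \<le> t" using i(1) by simp
    have "gcd k (r * 3 ^ t) dvd r * gcd k (3 ^ t)"
      by (metis gcd_dvd1 gcd_dvd2 gcd_greatest gcd_mult_distrib_nat dvd_mult)
    then have "3 ^ (e + t) dvd fundamental_seq b (r * 3 ^ i)"
      unfolding i(2) using u fundamental_dvd dvd_trans by blast
    moreover have "(3 :: nat) ^ Suc (e + i) dvd 3 ^ (e + t)"
      using \<open>Suc i \<le> t\<close> by (intro le_imp_power_dvd) simp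
    ultimately show False using exact[of i] dvd_trans by blast
  qed
  moreover have "coprime r (3 ^ t)"
    using r(1) by (simp add: coprime_commute[of 2])
  ultimately show ?thesis using \<open>r dvd k\<close> divides_mult by blast
qed

section \<open>Excluding the indices 2 q and 4 q for primes q > 3\<close>

lemma coprime_3_power:
  fixes x :: nat assumes "\<not> 3 dvd x" shows "coprime (3 ^ n) x"
proof -
  have "prime (3 :: nat)" by simp
  then have "coprime 3 x" using assms by (rule prime_imp_coprime)
  then show ?thesis by simp
qed

lemma power_dvd_mult_cancel_9:
  fixes x y :: nat
  assumes "3 ^ Suc n dvd x * y" "\<not> 9 dvd x" shows "3 ^ n dvd y"
proof (cases "3 dvd x")
  case True
  then obtain z where z: "x = 3 * z" by blast
  have "3 * 3 ^ n dvd 3 * (z * y)" using assms(1) z by (simp add: mult.assoc)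
  then have "3 ^ n dvd z * y" by (metis dvd_times_left_cancel_iff zero_neq_numeral)
  moreover have "\<not> 3 dvd z" using assms(2) z by auto
  ultimately show ?thesis using coprime_3_power coprime_dvd_mult_right_iff by blast
next
  case False
  then have "3 ^ Suc n dvd y" using assms(1) coprime_3_power coprime_dvd_mult_right_iff by blast
  then show ?thesis by (metis dvd_trans le_imp_power_dvd le_SucI order_refl)
qed

text \<open>Serves b = 5 and b = 7, where 3 has rank 4. The product u_(q+1) u_(q-1) is divisible by
  3^(e+j), and only one of q + 1, q - 1 is a multiple of 4, so one factor carries the whole power.
  Then 4 * 3^j is at most q + 1, against 2 q <= 3^j + 1.\<close>

lemma not_smooth_totient_double_prime:
  assumes b: "odd b" "\<not> 3 dvd b" "\<not> 3 dvd b ^ 2 + 4"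
    and e: "e > 0" "3 ^ e dvd companion_seq b 2" "\<not> 3 ^ Suc e dvd companion_seq b 2"
    and q: "prime q" "q > 3"
  shows "\<not> smooth (totient (companion_seq b (2 * q)))"
proof
  let ?u = "fundamental_seq b"
  assume "smooth (totient (companion_seq b (2 * q)))"
  then obtain j where j: "2 * q dvd 3 ^ j + 1"
    and dvd: "3 ^ j * V b 2 dvd V b (2 * q) - V b 2"
    using smooth_totient_multiple_imp(2)[OF b(1) q, of 1] by auto
  have "odd q" using prime_greater_3_not_dvd[OF q] by blast
  have "V b (2 * q) - V b 2 = int ((b ^ 2 + 4) * (?u (q + 1) * ?u (q - 1)))"
    using companion_diff_odd_multiple[OF \<open>odd q\<close>, of b 0] by simp
  then have "3 ^ j * companion_seq b 2 dvd (b ^ 2 + 4) * (?u (q + 1) * ?u (q - 1))"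
    using dvd by (metis of_nat_dvd_iff of_nat_mult of_nat_numeral of_nat_power)
  moreover have "3 ^ (e + j) dvd 3 ^ j * companion_seq b 2"
    using e(2) by (simp add: power_add mult.commute)
  ultimately have "3 ^ (e + j) dvd (b ^ 2 + 4) * (?u (q + 1) * ?u (q - 1))"
    using dvd_trans by blast
  then have prod: "3 ^ (e + j) dvd ?u (q + 1) * ?u (q - 1)"
    using coprime_3_power[OF b(3)] coprime_dvd_mult_right_iff by blast
  have u2: "?u 2 = b" by (simp add: numeral_2_eq_2)
  have u4: "?u 4 = b * companion_seq b 2" using fundamental_double_nat[of b 2] u2 by simp
  have rank: "4 dvd k" if "3 dvd ?u k" for k
  proof (rule three_dvd_fundamental_imp_rank_dvd[of 4 2, OF _ _ _ _ that])
    have "3 dvd (3 :: nat) ^ e" using e(1) by simp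
    then show "3 dvd ?u 4" unfolding u4 using e(2) dvd_mult dvd_trans by blast
  qed (use u2 b(2) in auto)
  have exact: "4 * 3 ^ j dvd k" if "3 ^ (e + j) dvd ?u k" for k
  proof (rule three_power_dvd_fundamental_imp[of 4 2, OF _ _ _ e(1) _ _ that])
    show "3 ^ e dvd ?u 4" unfolding u4 using e(2) by simp
    show "\<not> 3 ^ Suc e dvd ?u 4"
      unfolding u4 using e(3) coprime_3_power[OF b(2)] coprime_dvd_mult_right_iff by blast
  qed (use u2 b(2) in auto)
  have le: "2 * q \<le> 3 ^ j + 1" using j by (rule dvd_imp_le) simp
  have "q mod 4 = 1 \<or> q mod 4 = 3" using \<open>odd q\<close> by presburger
  then show False
  proof
    assume "q mod 4 = 1"
    then have "\<not> 4 dvd q + 1" by presburger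
    then have "\<not> 3 dvd ?u (q + 1)" using rank by blast
    then have "3 ^ (e + j) dvd ?u (q - 1)"
      using prod coprime_3_power coprime_dvd_mult_right_iff by blast
    then have "4 * 3 ^ j dvd q - 1" by (rule exact)
    then have "4 * 3 ^ j \<le> q - 1" by (rule dvd_imp_le) (use q in simp)
    then show False using le q(2) by linarith
  next
    assume "q mod 4 = 3"
    moreover obtain x where x: "q = Suc x" using q(2) by (cases q) auto
    ultimately have "\<not> 4 dvd x" by presburger
    then have "\<not> 4 dvd q - 1" using x by simp
    then have "\<not> 3 dvd ?u (q - 1)" using rank by blast
    then have "3 ^ (e + j) dvd ?u (q + 1)"
      using prod coprime_3_power coprime_dvd_mult_left_iff by blast
    then have "4 * 3 ^ j dvd q + 1" by (rule exact)
    then have "4 * 3 ^ j \<le> q + 1" by (rule dvd_imp_le) simp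
    then show False using le q(2) by linarith
  qed
qed

text \<open>For b = 3 the rank of 3 is 2, so both values of u in the product are divisible by 3. One
  of them is not divisible by 9, so the other carries 3^(j-1). This puts q next to a multiple of 2 *
  3^(j-2), and size leaves a single candidate.\<close>

lemma companion_3_multiple_4_not_smooth:
  assumes q: "prime q" "q > 3"
  shows "\<not> smooth (totient (companion_seq 3 (4 * q)))"
proof
  let ?u = "fundamental_seq 3"
  assume "smooth (totient (companion_seq 3 (4 * q)))"
  then obtain j where prime: "prime (2 * 3 ^ j + 1 :: nat)" and j: "4 * q dvd 3 ^ j + 1"
    and dvd: "3 ^ j * V 3 4 dvd V 3 (4 * q) - V 3 4"
    using smooth_totient_multiple_imp(2)[OF _ q, of 3 2] by auto
  have q_odd: "odd q" "\<not> 3 dvd q" using prime_greater_3_not_dvd[OF q] by auto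
  have le: "4 * q \<le> 3 ^ j + 1" using j by (rule dvd_imp_le) simp
  have "j \<noteq> 0" "j \<noteq> 1" by (rule notI, use le q(2) in simp)+
  then obtain t where t: "j = Suc (Suc t)" by (metis One_nat_def not0_implies_Suc)
  have diff: "V 3 (4 * q) - V 3 4 = int (13 * (?u (2 * (q + 1)) * ?u (2 * (q - 1))))"
    using companion_diff_odd_multiple[OF q_odd(1), of 3 1] by simp
  have "int (3 ^ j) dvd V 3 (4 * q) - V 3 4"
    using dvd_mult_left[OF dvd] by simp
  then have "3 ^ j dvd 13 * (?u (2 * (q + 1)) * ?u (2 * (q - 1)))"
    unfolding diff of_nat_dvd_iff .
  moreover have "coprime (3 ^ j) (13 :: nat)" by (rule coprime_3_power) simp
  ultimately have "3 ^ j dvd ?u (2 * (q + 1)) * ?u (2 * (q - 1))"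
    using coprime_dvd_mult_right_iff by blast
  then have prod: "3 ^ Suc (1 + t) dvd ?u (2 * (q + 1)) * ?u (2 * (q - 1))"
    by (simp only: t add_Suc plus_1_eq_Suc add_0)
  then have prod': "3 ^ Suc (1 + t) dvd ?u (2 * (q - 1)) * ?u (2 * (q + 1))"
    by (simp only: mult.commute)
  have u: "?u 1 = 1" "?u 2 = 3" by (simp_all add: numeral_2_eq_2)
  have exact: "2 * 3 ^ i dvd k" if "3 ^ (1 + i) dvd ?u k" for i k
    by (rule three_power_dvd_fundamental_imp[of 2 1, OF _ _ _ _ _ _ that]) (use u in auto)
  \<comment> \<open>The valuation of u_2 = 3 is e = 1, so 9 divides u at an index only if 3 divides
    that index.\<close>
  have not9: "\<not> 9 dvd ?u (2 * k)" if "\<not> 3 dvd k" for k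
    using exact[of 1 "2 * k"] that by auto
  obtain x where x: "q = Suc x" "even x" using q_odd(1) by (cases q) auto
  have "\<not> 3 dvd q + 1 \<or> \<not> 3 dvd q - 1" unfolding x(1) by presburger
  then have "2 * 3 ^ t dvd 2 * (q - 1) \<or> 2 * 3 ^ t dvd 2 * (q + 1)"
  proof
    assume "\<not> 3 dvd q + 1"
    from exact[OF power_dvd_mult_cancel_9[OF prod not9[OF this]]] show ?thesis by blast
  next
    assume "\<not> 3 dvd q - 1"
    from exact[OF power_dvd_mult_cancel_9[OF prod' not9[OF this]]]
    show ?thesis by blast
  qed
  then have "3 ^ t dvd q - 1 \<or> 3 ^ t dvd q + 1" by (metis dvd_times_left_cancel_iff zero_neq_numeral)
  moreover have "coprime 2 ((3 :: nat) ^ t)" by simp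
  moreover have "2 dvd q - 1" "2 dvd q + 1" using x by auto
  ultimately have "2 * 3 ^ t dvd q - 1 \<or> 2 * 3 ^ t dvd q + 1" using divides_mult by blast
  then obtain c where "q - 1 = 2 * 3 ^ t * c \<or> q + 1 = 2 * 3 ^ t * c"
    by (elim disjE dvdE) auto
  then have c: "q = 2 * 3 ^ t * c + 1 \<or> q + 1 = 2 * 3 ^ t * c" using q(2) by linarith
  define d :: nat where "d = 3 ^ t"
  have d: "d > 0" by (simp add: d_def)
  have j9: "3 ^ j + 1 = 9 * d + 1" by (simp add: d_def t)
  have "c \<noteq> 0" using c q(2) by (cases c) auto
  \<comment> \<open>For c >= 2 one gets 4 d <= q + 1, which is too large for 4 q <= 9 d + 1.\<close>
  have "c < 2"
  proof (rule ccontr)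
    assume "\<not> c < 2"
    then have "2 * d * 2 \<le> 2 * d * c" by simp
    then have "4 * d \<le> q + 1" using c unfolding d_def by linarith
    then show False using le d unfolding j9 by linarith
  qed
  then have "c = 1" using \<open>c \<noteq> 0\<close> by simp
  then have qd: "q = 2 * d + 1 \<or> q + 1 = 2 * d" using c by (simp add: d_def)
  obtain s where s: "9 * d + 1 = 4 * q * s" using j unfolding j9 by blast
  have "s < 2"
  proof (rule ccontr)
    assume "\<not> s < 2"
    then have "4 * q * 2 \<le> 4 * q * s" by simp
    then have "8 * q \<le> 9 * d + 1" using s by simp
    then show False using qd q(2) by linarith
  qed
  moreover have "s \<noteq> 0" using s by (cases s) auto
  ultimately have "s = 1" by simp
  \<comment> \<open>From 9 d + 1 = 4 q: q = 2 d + 1 gives d = 3, and q = 2 d - 1 gives no solution.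
    So j = 3 and the supposed prime 2 * 3^j + 1 is 55.\<close>
  then have "d = 3" using s qd by auto
  then have "3 ^ t = (3 :: nat) ^ 1" by (simp add: d_def)
  then have "t = 1" by (rule power_inject_exp[THEN iffD1, rotated]) simp
  then have "prime (55 :: nat)" using prime t by simp
  then show False by simp
qed

text \<open>With n = 2^a m and m odd, v_n is divisible by v_(2^a) and by v_(2^a q) for each prime q
  dividing m. The first gives a <= 2, the second forces a > 0 if q > 3. The cases a = 1 and a = 2
  depend on b and enter as hypotheses.\<close>

lemma smooth_totient_companion_index:
  assumes b: "odd b" and n: "n > 0" and sm: "smooth (totient (companion_seq b n))"
    and no_2q: "\<And>q. prime q \<Longrightarrow> q > 3 \<Longrightarrow> \<not> smooth (totient (companion_seq b (2 * q)))"
    and no_4q: "\<And>q. prime q \<Longrightarrow> q > 3 \<Longrightarrow> \<not> smooth (totient (companion_seq b (4 * q)))"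
  shows "\<exists>a c. a \<le> 2 \<and> n = 2 ^ a * 3 ^ c"
proof -
  obtain m where "n = 2 ^ multiplicity 2 n * m" "odd m"
    using multiplicity_decompose'[of n 2] n by auto
  then obtain a where am: "n = 2 ^ a * m" "odd m" by blast
  have "smooth (totient (companion_seq b (2 ^ a)))"
    using smooth_totient_dvd[OF sm] companion_dvd_odd_mult[OF am(2)] am(1) by simp
  then have "a \<le> 2" using companion_two_power_not_smooth[OF b, of a] by force
  have "smooth m"
    unfolding smooth_def
  proof (intro allI impI, rule ccontr)
    fix q assume q: "prime q" "q dvd m" "\<not> q \<le> 3"
    then obtain k where k: "m = q * k" by blast
    then have "n = 2 ^ a * q * k" "odd k" using am by auto
    then have "smooth (totient (companion_seq b (2 ^ a * q)))"
      using smooth_totient_dvd[OF sm] companion_dvd_odd_mult[of k b "2 ^ a * q"] by simp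
    moreover from smooth_totient_multiple_imp(1)[OF b q(1) _ this] q(3)
    have "a = 1 \<or> a = 2" using \<open>a \<le> 2\<close> by auto
    ultimately show False using no_2q[OF q(1)] no_4q[OF q(1)] q(3) by auto
  qed
  then obtain x c where xc: "m = 2 ^ x * 3 ^ c"
    using smooth_imp_power_form am(2) odd_pos by blast
  then have "x = 0" using am(2) by (cases x) auto
  then have "n = 2 ^ a * 3 ^ c" using am(1) xc by simp
  then show ?thesis using \<open>a \<le> 2\<close> by blast
qed

subsection \<open>Explicit values\<close>

text \<open>Negative terms are moved to the left so that the identities hold over the natural
  numbers.\<close>

lemma companion_double_even: "even n \<Longrightarrow> companion_seq b (2 * n) + 2 = companion_seq b n ^ 2"
  and companion_double_odd: "odd n \<Longrightarrow> companion_seq b (2 * n) = companion_seq b n ^ 2 + 2"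
proof -
  assume "even n"
  then have "int (companion_seq b (2 * n) + 2) = int (companion_seq b n ^ 2)"
    using companion_double[of b n] by simp
  then show "companion_seq b (2 * n) + 2 = companion_seq b n ^ 2" by (simp only: of_nat_eq_iff)
next
  assume "odd n"
  then have "int (companion_seq b (2 * n)) = int (companion_seq b n ^ 2 + 2)"
    using companion_double[of b n] by simp
  then show "companion_seq b (2 * n) = companion_seq b n ^ 2 + 2" by (simp only: of_nat_eq_iff)
qed

lemma companion_triple_even:
    "even n \<Longrightarrow> companion_seq b (3 * n) + 3 * companion_seq b n = companion_seq b n ^ 3"
  and companion_triple_odd:
    "odd n \<Longrightarrow> companion_seq b (3 * n) = companion_seq b n ^ 3 + 3 * companion_seq b n"
proof -
  have "n + 2 * n = 3 * n" "n + n = 2 * n" by simp_all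
  then have triple: "V b (3 * n) = V b (2 * n) * V b n - (-1) ^ n * V b n"
    using companion_shift[of b n n] by (simp only:)
  { assume "even n"
    then have "int (companion_seq b (3 * n) + 3 * companion_seq b n) = int (companion_seq b n ^ 3)"
      unfolding of_nat_add triple companion_double
      by (simp add: power2_eq_square power3_eq_cube algebra_simps)
    then show "companion_seq b (3 * n) + 3 * companion_seq b n = companion_seq b n ^ 3"
      by (simp only: of_nat_eq_iff)
  next
    assume "odd n"
    then have "int (companion_seq b (3 * n)) = int (companion_seq b n ^ 3 + 3 * companion_seq b n)"
      unfolding triple companion_double
      by (simp add: power2_eq_square power3_eq_cube algebra_simps)
    then show "companion_seq b (3 * n) = companion_seq b n ^ 3 + 3 * companion_seq b n"
      by (simp only: of_nat_eq_iff) }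
qed

lemma companion_1: "companion_seq b 1 = b" by simp
lemma companion_2: "companion_seq b 2 = b ^ 2 + 2"
  using companion_double_odd[of 1 b] by simp
lemma companion_3: "companion_seq b 3 = b ^ 3 + 3 * b"
  using companion_triple_odd[of 1 b] by simp
lemma companion_4: "companion_seq b 4 + 2 = companion_seq b 2 ^ 2"
  using companion_double_even[of 2 b] by simp
lemma companion_6: "companion_seq b 6 + 3 * companion_seq b 2 = companion_seq b 2 ^ 3"
  using companion_triple_even[of 2 b] by simp
lemma companion_9: "companion_seq b 9 = companion_seq b 3 ^ 3 + 3 * companion_seq b 3"
  using companion_triple_odd[of 3 b] by simp
lemma companion_12: "companion_seq b 12 + 3 * companion_seq b 4 = companion_seq b 4 ^ 3"
  using companion_triple_even[of 4 b] by simp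
lemma companion_18: "companion_seq b 18 + 3 * companion_seq b 6 = companion_seq b 6 ^ 3"
  using companion_triple_even[of 6 b] by simp
lemma companion_27: "companion_seq b 27 = companion_seq b 9 ^ 3 + 3 * companion_seq b 9"
  using companion_triple_odd[of 9 b] by simp

lemma companion_3_values:
  "companion_seq 3 2 = 11" "companion_seq 3 3 = 36" "companion_seq 3 4 = 119"
  "companion_seq 3 9 = 46764" "companion_seq 3 12 = 1684802" "companion_seq 3 27 = 102266868132036"
proof -
  show 2: "companion_seq 3 2 = 11" unfolding companion_2 by simp
  show 3: "companion_seq 3 3 = 36" unfolding companion_3 by simp
  show 4: "companion_seq 3 4 = 119" using companion_4[of 3] unfolding 2 by simp
  show 9: "companion_seq 3 9 = 46764" unfolding companion_9 3 by simp
  show "companion_seq 3 12 = 1684802" using companion_12[of 3] unfolding 4 by simp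
  show "companion_seq 3 27 = 102266868132036" unfolding companion_27 9 by simp
qed

lemma companion_5_values:
  "companion_seq 5 2 = 27" "companion_seq 5 3 = 140" "companion_seq 5 4 = 727"
  "companion_seq 5 6 = 19602" "companion_seq 5 9 = 2744420"
proof -
  show 2: "companion_seq 5 2 = 27" unfolding companion_2 by simp
  show 3: "companion_seq 5 3 = 140" unfolding companion_3 by simp
  show 4: "companion_seq 5 4 = 727" using companion_4[of 5] unfolding 2 by simp
  show "companion_seq 5 6 = 19602" using companion_6[of 5] unfolding 2 by simp
  show 9: "companion_seq 5 9 = 2744420" unfolding companion_9 3 by simp
qed

lemma companion_7_values:
  "companion_seq 7 2 = 51" "companion_seq 7 3 = 364" "companion_seq 7 4 = 2599"
  "companion_seq 7 6 = 132498" "companion_seq 7 9 = 48229636" "companion_seq 7 18 = 2326097788692498"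
proof -
  show 2: "companion_seq 7 2 = 51" unfolding companion_2 by simp
  show 3: "companion_seq 7 3 = 364" unfolding companion_3 by simp
  show 4: "companion_seq 7 4 = 2599" using companion_4[of 7] unfolding 2 by simp
  show 6: "companion_seq 7 6 = 132498" using companion_6[of 7] unfolding 2 by simp
  show 9: "companion_seq 7 9 = 48229636" unfolding companion_9 3 by simp
  show "companion_seq 7 18 = 2326097788692498" using companion_18[of 7] unfolding 6 by simp
qed

text \<open>A number that is \<open>3\<close> modulo \<open>4\<close> has a prime factor of the same kind, and smoothness would
  make it \<open>2 * 3 ^ j + 1\<close>. This avoids primality proofs for large factors.\<close>

lemma not_smooth_totientI:
  assumes N: "X dvd N" and X: "X mod 4 = 3" "X < 2 * 3 ^ k"
    and div: "\<forall>j\<in>set [0..<k]. \<not> 2 * 3 ^ j + 1 dvd X"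
  shows "\<not> smooth (totient N)"
proof
  assume sm: "smooth (totient N)"
  obtain p where p: "prime p" "p dvd X" "p mod 4 = 3" using prime_factor_3_mod_4[OF X(1)] by blast
  have "p dvd N" using p(2) N by (rule dvd_trans)
  then obtain j where j: "p = 2 * 3 ^ j + 1"
    using smooth_pred_inert_prime[OF p(1) smooth_totient_prime_factor[OF sm p(1)] p(3)] by blast
  have "X > 0" using X(1) by (intro Nat.gr0I) simp
  with p(2) have "p \<le> X" by (rule dvd_imp_le)
  then have "(3 :: nat) ^ j < 3 ^ k" using X(2) j by linarith
  then have "j < k" by (rule power_less_imp_less_exp[rotated]) simp
  then show False using div p(2) unfolding j by simp
qed

text \<open>Each witness is a divisor that is 3 modulo 4. The large ones come from v_(3m) / v_m =
  v_m^2 + 3 (m odd) or v_m^2 - 3 (m even): 7079 = (119^2 - 3) / 2, 793207 = (46764^2 + 3) / 2757,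
  19603 = 140^2 + 3, 132499 = 364^2 + 3, 5851906667 = (132498^2 - 3) / 3. The second number only has
  to satisfy 2 * 3^k > X.\<close>

lemma not_smooth_companion_values:
  "\<not> smooth (totient (companion_seq 3 2))" "\<not> smooth (totient (companion_seq 3 12))"
  "\<not> smooth (totient (companion_seq 3 27))" "\<not> smooth (totient (companion_seq 5 4))"
  "\<not> smooth (totient (companion_seq 5 6))" "\<not> smooth (totient (companion_seq 5 9))"
  "\<not> smooth (totient (companion_seq 7 4))" "\<not> smooth (totient (companion_seq 7 9))"
  "\<not> smooth (totient (companion_seq 7 18))"
  unfolding companion_3_values companion_5_values companion_7_values
          apply (rule not_smooth_totientI[of 11 _ 2]; simp add: upt_rec)
         apply (rule not_smooth_totientI[of 7079 _ 8]; simp add: upt_rec)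
        apply (rule not_smooth_totientI[of 793207 _ 12]; simp add: upt_rec)
       apply (rule not_smooth_totientI[of 727 _ 6]; simp add: upt_rec)
      apply (rule not_smooth_totientI[of 11 _ 2]; simp add: upt_rec)
     apply (rule not_smooth_totientI[of 19603 _ 9]; simp add: upt_rec)
    apply (rule not_smooth_totientI[of 23 _ 3]; simp add: upt_rec)
   apply (rule not_smooth_totientI[of 132499 _ 11]; simp add: upt_rec)
  apply (rule not_smooth_totientI[of 5851906667 _ 20]; simp add: upt_rec)
  done

lemma prime_if_no_small_divisor:
  fixes n :: nat
  assumes "n > 1" "n < k * k" "\<forall>d\<in>set [2..<k]. \<not> d dvd n"
  shows "prime n"
  unfolding prime_nat_iff
proof (intro conjI allI impI)
  fix m assume "m dvd n"
  then obtain l where l: "n = m * l" by blast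
  have large: "d = 1 \<or> k \<le> d" if "d dvd n" for d
  proof -
    have "d \<noteq> 0" using that assms(1) by (intro notI) simp
    then show ?thesis using assms(3) that by (cases "d = 1") force+
  qed
  have "\<not> (k \<le> m \<and> k \<le> l)" using mult_le_mono assms(2) l by (metis leD)
  then have "m = 1 \<or> l = 1" using large[of m] large[of l] l by auto
  then show "m = 1 \<or> m = n" using l by auto
qed (use assms in simp)

lemma totient_values:
  "totient 3 = 2" "totient 5 = 4" "totient 7 = 6" "totient 36 = 12" "totient 119 = 96"
  "totient 46764 = 15552" "totient 27 = 18" "totient 140 = 48" "totient 51 = 32" "totient 364 = 144"
  "totient 132498 = 41472"
proof -
  have t13: "totient 13 = 12" and t17: "totient 17 = 16"
    by (subst totient_prime; simp)+
  \<comment> \<open>The factor 433 occurs in 46764 = 108 * 433 and 132498 = 306 * 433; trial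
    division below 21 suffices as 21^2 = 441.\<close>
  have "prime (433 :: nat)"
    by (rule prime_if_no_small_divisor[of _ 21]) (simp_all add: upt_rec)
  then have t433: "totient 433 = 432" by (simp add: totient_prime del: prime_nat_numeral_eq)
  show t3: "totient 3 = 2" and t5: "totient 5 = 4" and t7: "totient 7 = 6"
    by (subst totient_prime; simp)+
  have t9: "totient 9 = 6" using totient_prime_power[of 3 2] by simp
  show t27: "totient 27 = 18" using totient_prime_power[of 3 3] by simp
  have mult: "totient (m * n) = totient m * totient n" if "gcd m n = 1" for m n
    by (rule totient_mult_coprime) (use that in \<open>simp only: coprime_iff_gcd_eq_1\<close>)
  show "totient 36 = 12" using mult[of 4 9] t9 by (simp add: gcd_non_0_nat)
  show "totient 119 = 96" using mult[of 7 17] t7 t17 by (simp add: gcd_non_0_nat)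
  have "totient 108 = 36" using mult[of 4 27] t27 by (simp add: gcd_non_0_nat)
  then show "totient 46764 = 15552" using mult[of 108 433] t433 by (simp add: gcd_non_0_nat)
  have "totient 20 = 8" using mult[of 4 5] t5 by (simp add: gcd_non_0_nat)
  then show "totient 140 = 48" using mult[of 20 7] t7 by (simp add: gcd_non_0_nat)
  show "totient 51 = 32" using mult[of 3 17] t3 t17 by (simp add: gcd_non_0_nat)
  have "totient 28 = 12" using mult[of 4 7] t7 by (simp add: gcd_non_0_nat)
  then show "totient 364 = 144" using mult[of 28 13] t13 by (simp add: gcd_non_0_nat)
  have "totient 18 = 6" using mult[of 2 9] t9 by (simp add: gcd_non_0_nat)
  then have "totient 306 = 96" using mult[of 18 17] t17 by (simp add: gcd_non_0_nat)
  then show "totient 132498 = 41472" using mult[of 306 433] t433 by (simp add: gcd_non_0_nat)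
qed

lemma smooth_companion_index_dvd:
  assumes "smooth (totient (companion_seq b (m * k)))" "odd k"
  shows "smooth (totient (companion_seq b m))"
  using smooth_totient_dvd[OF assms(1) companion_dvd_odd_mult[OF assms(2)]] .

text \<open>For c >= d the index m 3^c is an odd multiple of m 3^d, so one failing exponent excludes
  all larger ones.\<close>

lemma power_3_exponent_bound:
  assumes "smooth (totient (companion_seq b (m * 3 ^ c)))"
    and "\<not> smooth (totient (companion_seq b (m * 3 ^ d)))"
  shows "c < d"
proof (rule ccontr)
  assume "\<not> c < d"
  then have "m * 3 ^ c = m * 3 ^ d * 3 ^ (c - d)" by (simp flip: power_add)
  with assms(1) have "smooth (totient (companion_seq b (m * 3 ^ d * 3 ^ (c - d))))" by (simp only:)
  then have "smooth (totient (companion_seq b (m * 3 ^ d)))" by (rule smooth_companion_index_dvd) simp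
  with assms(2) show False by blast
qed

section \<open>Admissible indices for b = 3, 5, 7\<close>

lemma smooth_index_3:
  assumes "smooth (totient (companion_seq 3 n))" shows "n \<in> {0, 1, 3, 4, 9}"
proof (cases "n = 0")
  case False
  \<comment> \<open>For b = 3 the value v_2 = 11 fails already, and it divides v_(2q).\<close>
  have no2: "\<not> smooth (totient (companion_seq 3 (2 * q)))" if "prime q" "q > 3" for q
    using smooth_companion_index_dvd[of 3 2 q] prime_greater_3_not_dvd(1)[OF that]
      not_smooth_companion_values(1) by blast
  obtain a c where ac: "a \<le> 2" "n = 2 ^ a * 3 ^ c"
    using smooth_totient_companion_index[of 3 n, OF _ _ assms no2 companion_3_multiple_4_not_smooth] False
    by auto
  note bound = power_3_exponent_bound[OF assms[unfolded ac(2)]]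
  consider "a = 0" | "a = 1" | "a = 2" using ac(1) by linarith
  then show ?thesis
  proof cases
    case 1
    then have "c < 3" using bound[of 3] not_smooth_companion_values by simp
    then consider "c = 0" | "c = 1" | "c = 2" by linarith
    then show ?thesis using ac(2) 1 by cases auto
  next
    case 2
    \<comment> \<open>A contradiction: the exponent 0 already fails, so a = 1 does not
      occur.\<close>
    then have "c < 0" using bound[of 0] not_smooth_companion_values by simp
    then show ?thesis by simp
  next
    case 3
    then have "c < 1" using bound[of 1] not_smooth_companion_values by simp
    then show ?thesis using ac(2) 3 by simp
  qed
qed simp

lemma smooth_index_5:
  assumes "smooth (totient (companion_seq 5 n))" shows "n \<in> {0, 1, 2, 3}"
proof (cases "n = 0")
  case False
  \<comment> \<open>The exponent e = 3 comes from v_2 = 27.\<close>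
  have no2: "\<not> smooth (totient (companion_seq 5 (2 * q)))" if "prime q" "q > 3" for q
    by (rule not_smooth_totient_double_prime[of 5 3, OF _ _ _ _ _ _ that])
      (simp_all add: companion_5_values)
  \<comment> \<open>The value v_4 = 727 fails and divides v_(4q).\<close>
  have no4: "\<not> smooth (totient (companion_seq 5 (4 * q)))" if "prime q" "q > 3" for q
    using smooth_companion_index_dvd[of 5 4 q] prime_greater_3_not_dvd(1)[OF that]
      not_smooth_companion_values by blast
  obtain a c where ac: "a \<le> 2" "n = 2 ^ a * 3 ^ c"
    using smooth_totient_companion_index[of 5 n, OF _ _ assms no2 no4] False by auto
  note bound = power_3_exponent_bound[OF assms[unfolded ac(2)]]
  consider "a = 0" | "a = 1" | "a = 2" using ac(1) by linarith
  then show ?thesis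
  proof cases
    case 1
    then have "c < 2" using bound[of 2] not_smooth_companion_values by simp
    then consider "c = 0" | "c = 1" by linarith
    then show ?thesis using ac(2) 1 by cases auto
  next
    case 2
    then have "c < 1" using bound[of 1] not_smooth_companion_values by simp
    then show ?thesis using ac(2) 2 by simp
  next
    case 3
    then have "c < 0" using bound[of 0] not_smooth_companion_values by simp
    then show ?thesis by simp
  qed
qed simp

lemma smooth_index_7:
  assumes "smooth (totient (companion_seq 7 n))" shows "n \<in> {0, 1, 2, 3, 6}"
proof (cases "n = 0")
  case False
  \<comment> \<open>Here e = 1, since v_2 = 51 = 3 * 17.\<close>
  have no2: "\<not> smooth (totient (companion_seq 7 (2 * q)))" if "prime q" "q > 3" for q
    by (rule not_smooth_totient_double_prime[of 7 1, OF _ _ _ _ _ _ that])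
      (simp_all add: companion_7_values)
  have no4: "\<not> smooth (totient (companion_seq 7 (4 * q)))" if "prime q" "q > 3" for q
    using smooth_companion_index_dvd[of 7 4 q] prime_greater_3_not_dvd(1)[OF that]
      not_smooth_companion_values by blast
  obtain a c where ac: "a \<le> 2" "n = 2 ^ a * 3 ^ c"
    using smooth_totient_companion_index[of 7 n, OF _ _ assms no2 no4] False by auto
  note bound = power_3_exponent_bound[OF assms[unfolded ac(2)]]
  consider "a = 0" | "a = 1" | "a = 2" using ac(1) by linarith
  then show ?thesis
  proof cases
    case 1
    then have "c < 2" using bound[of 2] not_smooth_companion_values by simp
    then consider "c = 0" | "c = 1" by linarith
    then show ?thesis using ac(2) 1 by cases auto
  next
    case 2
    then have "c < 2" using bound[of 2] not_smooth_companion_values by simp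
    then consider "c = 0" | "c = 1" by linarith
    then show ?thesis using ac(2) 2 by cases auto
  next
    case 3
    then have "c < 0" using bound[of 0] not_smooth_companion_values by simp
    then show ?thesis by simp
  qed
qed simp

lemma eq_power_form_iff:
  assumes "t = (2 :: nat) ^ c * 3 ^ d"
  shows "t = 2 ^ x * 3 ^ y \<longleftrightarrow> x = c \<and> y = d"
  unfolding assms using power_form_unique[of c d x y] by auto

text \<open>The exponents for b = 5, n = 2 and 3 and for b = 7, n = 3 come from phi(27) = 2 * 3^2,
  phi(140) = 2^4 * 3 and phi(364) = 2^4 * 3^2; they differ from those in the opening English
  sentence.\<close>

theorem theorem4:
  shows "{(n, x, y). totient (companion_seq 3 n) = 2 ^ x * 3 ^ y}
           = {(0, 0, 0), (1, 1, 0), (3, 2, 1), (4, 5, 1), (9, 6, 5)}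
       \<and> {(n, x, y). totient (companion_seq 5 n) = 2 ^ x * 3 ^ y}
           = {(0, 0, 0), (1, 2, 0), (2, 1, 2), (3, 4, 1)}
       \<and> {(n, x, y). totient (companion_seq 7 n) = 2 ^ x * 3 ^ y}
           = {(0, 0, 0), (1, 1, 1), (2, 5, 0), (3, 4, 2), (6, 9, 4)}"
proof -
  have index: "n \<in> S"
    if "\<And>n. smooth (totient (companion_seq b n)) \<Longrightarrow> n \<in> S"
      "totient (companion_seq b n) = 2 ^ x * 3 ^ y" for b n x y S
    using that smooth_2_power_3_power[of x y] by simp
  note evals = companion_1 companion_3_values companion_5_values companion_7_values totient_values
  have v0: "totient (companion_seq b 0) = 2 ^ x * 3 ^ y \<longleftrightarrow> x = 0 \<and> y = 0" for b x y
    by (rule eq_power_form_iff) simp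
  have v3: "totient (companion_seq 3 1) = 2 ^ x * 3 ^ y \<longleftrightarrow> x = 1 \<and> y = 0"
    "totient (companion_seq 3 3) = 2 ^ x * 3 ^ y \<longleftrightarrow> x = 2 \<and> y = 1"
    "totient (companion_seq 3 4) = 2 ^ x * 3 ^ y \<longleftrightarrow> x = 5 \<and> y = 1"
    "totient (companion_seq 3 9) = 2 ^ x * 3 ^ y \<longleftrightarrow> x = 6 \<and> y = 5" for x y
    by (unfold evals, (rule eq_power_form_iff, simp)+)
  have v5: "totient (companion_seq 5 1) = 2 ^ x * 3 ^ y \<longleftrightarrow> x = 2 \<and> y = 0"
    "totient (companion_seq 5 2) = 2 ^ x * 3 ^ y \<longleftrightarrow> x = 1 \<and> y = 2"
    "totient (companion_seq 5 3) = 2 ^ x * 3 ^ y \<longleftrightarrow> x = 4 \<and> y = 1" for x y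
    by (unfold evals, (rule eq_power_form_iff, simp)+)
  have v7: "totient (companion_seq 7 1) = 2 ^ x * 3 ^ y \<longleftrightarrow> x = 1 \<and> y = 1"
    "totient (companion_seq 7 2) = 2 ^ x * 3 ^ y \<longleftrightarrow> x = 5 \<and> y = 0"
    "totient (companion_seq 7 3) = 2 ^ x * 3 ^ y \<longleftrightarrow> x = 4 \<and> y = 2"
    "totient (companion_seq 7 6) = 2 ^ x * 3 ^ y \<longleftrightarrow> x = 9 \<and> y = 4" for x y
    by (unfold evals, (rule eq_power_form_iff, simp)+)
  have e3: "totient (companion_seq 3 n) = 2 ^ x * 3 ^ y \<longleftrightarrow>
      (n, x, y) \<in> {(0, 0, 0), (1, 1, 0), (3, 2, 1), (4, 5, 1), (9, 6, 5)}" for n x y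
  proof (cases "n \<in> {0, 1, 3, 4, 9}")
    case True
    then show ?thesis using v0[of 3 x y] v3[of x y] by (elim insertE emptyE; simp only:) simp_all
  next
    case False
    then show ?thesis using index[OF smooth_index_3] by auto
  qed
  have e5: "totient (companion_seq 5 n) = 2 ^ x * 3 ^ y \<longleftrightarrow>
      (n, x, y) \<in> {(0, 0, 0), (1, 2, 0), (2, 1, 2), (3, 4, 1)}" for n x y
  proof (cases "n \<in> {0, 1, 2, 3}")
    case True
    then show ?thesis using v0[of 5 x y] v5[of x y] by (elim insertE emptyE; simp only:) simp_all
  next
    case False
    then show ?thesis using index[OF smooth_index_5] by auto
  qed
  have e7: "totient (companion_seq 7 n) = 2 ^ x * 3 ^ y \<longleftrightarrow>
      (n, x, y) \<in> {(0, 0, 0), (1, 1, 1), (2, 5, 0), (3, 4, 2), (6, 9, 4)}" for n x y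
  proof (cases "n \<in> {0, 1, 2, 3, 6}")
    case True
    then show ?thesis using v0[of 7 x y] v7[of x y] by (elim insertE emptyE; simp only:) simp_all
  next
    case False
    then show ?thesis using index[OF smooth_index_7] by auto
  qed
  show ?thesis unfolding e3 e5 e7 by auto
qed

end
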